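(* Fix $\theta>0$, $k\in\mathbb{N}$, and times $t_1<\dots<t_n$ in $[-\theta,0]$ and $s_1<\dots<s_m$ in $[0,\theta]$. Suppose we are given an increasing list of Young diagrams $\lambda^{(1)}\subset\dots\subset\lambda^{(n)}$, a decreasing list of Young diagrams $\mu^{(1)}\supset\dots\supset\mu^{(m)}$, and a Young diagram $\nu$ with $\nu\supset\lambda^{(n)}$ and $\nu\supset\mu^{(1)}$. Use the conventions $\lambda^{(0)}=\emptyset$, $\lambda^{(n+1)}=\nu$, $\mu^{(0)}=\nu$, $\mu^{(m+1)}=\emptyset$, $t_0=-\theta$, $t_{n+1}=0$, $s_0=0$, $s_{m+1}=\theta$. Then the $\mathcal{L}^{\theta,k}$-geometric weight RSK process $\lambda^{\theta,k}_{L,R}$ has the following finite dimensional distribution: $$\mathbf{P}\left(\bigcap_{i=1}^{n}\{\lambda^{\theta,k}_{L,R}(t_i)=\lambda^{(i)}\}\cap\{\lambda^{\theta,k}_{L,R}(0)=\nu\}\cap\bigcap_{j=1}^{m}\{\lambda^{\theta,k}_{L,R}(s_j)=\mu^{(j)}\}\right)$$ $$=\left(1-\frac{\theta^2}{k^2}\right)^{k^2}\left(\frac{\theta^2}{k^2}\right)^{|\nu|}\left(\prod_{i=0}^{n}\mathrm{Dim}_{\mathcal{L}^{\theta,k}(t_i,t_{i+1})}\left(\lambda^{(i+1)}/\lambda^{(i)}\right)\right)\cdot\left(\prod_{i=0}^{m}\mathrm{Dim}_{\mathcal{L}^{\theta,k}(s_i,s_{i+1})}\left(\mu^{(i)}/\mu^{(i+1)}\right)\right),$$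 where $\mathrm{Dim}_p(\lambda/\mu)$ is the number of semistandard Young tableaux of skew shape $\lambda/\mu$ whose entries do not exceed $p$, and $\mathcal{L}^{\theta,k}(x,y)=|\mathcal{L}^{\theta,k}\cap(x,y]|$ is the number of discretization points from $\mathcal{L}^{\theta,k}$ in the interval $(x,y]$.
   Context: $\mathbb{Y}$ is the set of Young diagrams, identified with sets of boxes: $(i,j)\in\lambda$ iff $j\le\lambda_i$; $|\nu|$ is the number of boxes of $\nu$. SSYT means semistandard Young tableau. $\mathcal{L}^{\theta,k}=\{\theta/k,2\theta/k,\dots,\theta\}$ is a discretization of $[0,\theta]$ with $k$ points. For an SSYT $T$ with entries not exceeding $k$, the $\mathcal{L}^{\theta,k}$-discretized Young diagram process of $T$ is $\lambda^{\theta,k}_T(t)=\{(i,j):T(i,j)\frac{\theta}{k}\le t\}$ for $t\ge0$. For two such SSYT $L,R$ of the same shape, the process $\lambda^{\theta,k}_{L,R}:[-\theta,\theta]\to\mathbb{Y}$ is defined by $\lambda^{\theta,k}_{L,R}(t)=\lambda^{\theta,k}_L(\theta+t)$ for $t\le0$ and $\lambda^{\theta,k}_{L,R}(t)=\lambda^{\theta,k}_R(\theta-t)$ for $t\ge0$. Let $\{\xi_{i,j}:1\le i,j\le k\}$ be i.i.d. geometric random variables with parameter $\theta^2/k^2$, i.e. $\mathbf{P}(\xi=x)=(1-\theta^2/k^2)(\theta^2/k^2)^x$ for $x=0,1,2,\dots$, and place exactly $\xi_{i,j}$ points at the location $(i\theta/k,j\theta/k)$. Regard the point configuration as a $k\times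 k$ matrix with entries in $\{0,1,2,\dots\}$ (equivalently a generalized permutation) and apply the Robinson–Schensted–Knuth (RSK) correspondence, the bijection between such matrices and pairs of SSYT of the same shape with entries not exceeding $k$, with $L$ the insertion tableau and $R$ the recording tableau. The Young diagram process $\lambda^{\theta,k}_{L,R}$ of the resulting random pair $(L,R)$ is the $\mathcal{L}^{\theta,k}$-geometric weight RSK process.
   Formalization: The printed counts over (t_i,t_{i+1}] and (s_i,s_{i+1}] are replaced by the numbers of discretization points in (θ+t_i,θ+t_{i+1}] and (θ−s_{i+1},θ−s_i]; as printed the first are always 0 and the second fail at times off the grid. *)

theory Defs
  imports "HOL-Probability.Probability"
begin

type_synonym box = "nat \<times> nat"

text \<open>Rows and columns of boxes are numbered from 1; the value \<open>p 0\<close> is irrelevant.\<close>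

definition partition_seq :: "(nat \<Rightarrow> nat) \<Rightarrow> bool" where
  "partition_seq p \<longleftrightarrow> (\<forall>i\<ge>1. p (Suc i) \<le> p i) \<and> finite {i. i \<ge> 1 \<and> p i \<noteq> 0}"

definition young_diagram :: "box set \<Rightarrow> bool" where
  "young_diagram D \<longleftrightarrow>
     (\<exists>p. partition_seq p \<and> D = {(i, j). 1 \<le> i \<and> 1 \<le> j \<and> j \<le> p i})"

definition semistandard :: "box set \<Rightarrow> (box \<Rightarrow> nat) \<Rightarrow> bool" where
  "semistandard D T \<longleftrightarrow>
     (\<forall>i j j'. (i, j) \<in> D \<and> (i, j') \<in> D \<and> j < j' \<longrightarrow> T (i, j) \<le> T (i, j')) \<and>
     (\<forall>i i' j. (i, j) \<in> D \<and> (i', j) \<in> D \<and> i < i' \<longrightarrow> T (i, j) < T (i', j))"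

text \<open>The number of semistandard tableaux of skew shape \<open>\<lambda>/\<mu>\<close> with entries in \<open>{1..p}\<close>;
  the function space \<open>PiE\<close> makes a tableau determined by its values on the boxes.
  The empty skew shape has exactly one tableau, also for \<open>p = 0\<close>.\<close>

definition skew_dim :: "nat \<Rightarrow> box set \<Rightarrow> box set \<Rightarrow> nat" where
  "skew_dim p lam mu = card {T \<in> (lam - mu) \<rightarrow>\<^sub>E {1..p}. semistandard (lam - mu) T}"

text \<open>Tableaux of straight shape, as lists of rows.\<close>

type_synonym tableau = "nat list list"

definition shape :: "tableau \<Rightarrow> box set" where
  "shape T = {(i, j). 1 \<le> i \<and> i \<le> length T \<and> 1 \<le> j \<and> j \<le> length (T ! (i - 1))}"

definition entry :: "tableau \<Rightarrow> box \<Rightarrow> nat" where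
  "entry T b = T ! (fst b - 1) ! (snd b - 1)"

text \<open>Schensted row insertion: \<open>x\<close> replaces the leftmost entry strictly greater than \<open>x\<close>, which
  is bumped, and is appended if there is none.\<close>

fun row_insert :: "nat \<Rightarrow> nat list \<Rightarrow> nat list \<times> nat option" where
  "row_insert x [] = ([x], None)"
| "row_insert x (y # ys) =
     (if x < y then (x # ys, Some y)
      else (case row_insert x ys of (ys', b) \<Rightarrow> (y # ys', b)))"

text \<open>\<open>rsk_insert a x (L, R)\<close> inserts \<open>x\<close> into \<open>L\<close> and puts the label \<open>a\<close> into the
  new box of \<open>R\<close>. The last equation is never used for tableaux of the same shape.\<close>

fun rsk_insert :: "nat \<Rightarrow> nat \<Rightarrow> tableau \<times> tableau \<Rightarrow> tableau \<times> tableau" where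
  "rsk_insert a x ([], R) = ([[x]], [[a]])"
| "rsk_insert a x (r # L, q # R) =
     (case row_insert x r of
        (r', None) \<Rightarrow> (r' # L, (q @ [a]) # R)
      | (r', Some y) \<Rightarrow> (case rsk_insert a y (L, R) of (L', R') \<Rightarrow> (r' # L', q # R')))"
| "rsk_insert a x (r # L, []) = (r # L, [])"

text \<open>The generalized permutation of a matrix lists \<open>(i, j)\<close> in lexicographic order, with
  multiplicity \<open>A i j\<close>; the \<open>j\<close>s are inserted and the \<open>i\<close>s are recorded.\<close>

definition generalized_permutation :: "nat \<Rightarrow> (nat \<Rightarrow> nat \<Rightarrow> nat) \<Rightarrow> (nat \<times> nat) list" where
  "generalized_permutation k A =
     concat (map (\<lambda>i. concat (map (\<lambda>j. replicate (A i j) (i, j)) [1..<Suc k])) [1..<Suc k])"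

definition rsk :: "nat \<Rightarrow> (nat \<Rightarrow> nat \<Rightarrow> nat) \<Rightarrow> tableau \<times> tableau" where
  "rsk k A = fold (\<lambda>(i, j). rsk_insert i j) (generalized_permutation k A) ([], [])"

definition tableau_process :: "real \<Rightarrow> nat \<Rightarrow> tableau \<Rightarrow> real \<Rightarrow> box set" where
  "tableau_process \<theta> k T t = {b \<in> shape T. real (entry T b) * (\<theta> / real k) \<le> t}"

definition pair_process :: "real \<Rightarrow> nat \<Rightarrow> tableau \<times> tableau \<Rightarrow> real \<Rightarrow> box set" where
  "pair_process \<theta> k LR t =
     (if t \<le> 0 then tableau_process \<theta> k (fst LR) (\<theta> + t)
      else tableau_process \<theta> k (snd LR) (\<theta> - t))"

definition (in prob_space) iid_geometric ::
    "real \<Rightarrow> nat \<Rightarrow> (nat \<Rightarrow> nat \<Rightarrow> 'a \<Rightarrow> nat) \<Rightarrow> bool" where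
  "iid_geometric \<theta> k \<xi> \<longleftrightarrow>
     indep_vars (\<lambda>_. count_space UNIV) (\<lambda>(i, j). \<xi> i j) ({1..k} \<times> {1..k}) \<and>
     (\<forall>i\<in>{1..k}. \<forall>j\<in>{1..k}. \<forall>x.
        prob {\<omega> \<in> space M. \<xi> i j \<omega> = x} = (1 - \<theta>\<^sup>2 / (real k)\<^sup>2) * (\<theta>\<^sup>2 / (real k)\<^sup>2) ^ x)"

definition geometric_rsk_process ::
    "real \<Rightarrow> nat \<Rightarrow> (nat \<Rightarrow> nat \<Rightarrow> 'a \<Rightarrow> nat) \<Rightarrow> 'a \<Rightarrow> real \<Rightarrow> box set" where
  "geometric_rsk_process \<theta> k \<xi> \<omega> t = pair_process \<theta> k (rsk k (\<lambda>i j. \<xi> i j \<omega>)) t"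

definition discretization :: "real \<Rightarrow> nat \<Rightarrow> real set" where
  "discretization \<theta> k = (\<lambda>a. real a * (\<theta> / real k)) ` {1..k}"

text \<open>The process \<open>pair_process\<close> runs the clock of \<open>L\<close> at time \<open>\<theta> + t\<close> and the clock
  of \<open>R\<close> backwards at time \<open>\<theta> - t\<close>, while the points of \<open>discretization\<close> lie in \<open>(0, \<theta>]\<close>. The points
  met by the process between times \<open>x < y\<close> are therefore those in \<open>(\<theta> + x, \<theta> + y]\<close> if
  \<open>y \<le> 0\<close>, and those in \<open>(\<theta> - y, \<theta> - x]\<close> if \<open>x \<ge> 0\<close>. In the second case their number is also
  the number of points in \<open>(x, y]\<close> when \<open>x\<close> and \<open>y\<close> are grid points, see
  \<open>lattice_count_reflect\<close> below, but not in general.\<close>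

definition lattice_count :: "real \<Rightarrow> nat \<Rightarrow> real \<Rightarrow> real \<Rightarrow> nat" where
  "lattice_count \<theta> k x y = card (discretization \<theta> k \<inter> {x<..y})"

lemma lattice_count_grid:
  assumes "\<theta> > 0" "k \<ge> 1" "b \<le> k"
  shows "lattice_count \<theta> k (real a * (\<theta> / real k)) (real b * (\<theta> / real k)) = b - a"
proof -
  let ?h = "\<theta> / real k"
  have h: "?h > 0" using assms by simp
  have "discretization \<theta> k \<inter> {real a * ?h<..real b * ?h} = (\<lambda>c. real c * ?h) ` {a<..b}"
    using assms unfolding discretization_def
    by (auto simp: mult_less_cancel_right_pos[OF h] mult_le_cancel_right_pos[OF h]
          simp del: times_divide_eq_right)
  moreover have "inj_on (\<lambda>c::nat. real c * ?h) {a<..b}"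
    using h by (auto simp: inj_on_def)
  ultimately show ?thesis
    unfolding lattice_count_def by (simp add: card_image del: times_divide_eq_right)
qed

lemma lattice_count_reflect:
  assumes "\<theta> > 0" "k \<ge> 1" "a \<le> b" "b \<le> k"
    and "x = real a * (\<theta> / real k)" "y = real b * (\<theta> / real k)"
  shows "lattice_count \<theta> k (\<theta> - y) (\<theta> - x) = lattice_count \<theta> k x y"
proof -
  have "\<theta> - y = real (k - b) * (\<theta> / real k)" "\<theta> - x = real (k - a) * (\<theta> / real k)"
    using assms by (simp_all add: of_nat_diff field_simps)
  then show ?thesis
    using assms lattice_count_grid[of \<theta> k "k - a" "k - b"] lattice_count_grid[of \<theta> k b a]
    by simp
qed

end

theory Submission
  imports Defs
begin

text \<open>
  Let \<open>\<Lambda>(i, j)\<close> be the shape of the entries \<open>\<le> j\<close> in the insertion tableau after the first \<open>i\<close> rows of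
  the matrix. Inserting a sorted word into a sorted row changes the number of entries \<open>\<le> j\<close> by a
  max-plus recursion, and the multiplicities of the bumped word are given by the corresponding
  minimum. Hence \<open>\<Lambda>(i+1, j+1)\<close> is a function of \<open>\<Lambda>(i, j)\<close>, \<open>\<Lambda>(i, j+1)\<close>, \<open>\<Lambda>(i+1, j)\<close> and one matrix
  entry. This local rule can be run backwards, so the matrix corresponds bijectively to the pair of
  chains \<open>\<Lambda>(k, _)\<close> and \<open>\<Lambda>(_, k)\<close>, which are the chains of sublevel sets of the two tableaux.

  By independence a matrix has probability \<open>(1 - q)^(k^2) q^|\<nu>|\<close> with \<open>q = \<theta>^2 / k^2\<close>, which depends only
  on the shape \<open>\<nu>\<close>. The event fixes the shape and some sublevel sets of each tableau, and cutting a
  tableau along these sublevel sets gives the products of numbers of skew tableaux.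
\<close>

section \<open>Row insertion of sorted words\<close>

text \<open>Reverse bumping of tableaux is avoided. A sorted word bumps a sorted word out of a
  sorted row, so every tableau row can process a whole matrix row and hand the bumped word down;
  insertion thus becomes a recursion on counts. Inverting it is a matter of sequences of natural
  numbers: the matrix entry of a square enters only the first row length, and every later row can be
  solved for the corner nearest the origin. Interlacing of neighbouring shapes keeps the truncated
  subtraction exact in both directions, and it yields the strict columns of both tableaux at once.
  The clock of the recording tableau runs backwards, so its chain is indexed in reverse and the
  second product counts points in reflected intervals.\<close>

definition row_count :: "nat list \<Rightarrow> nat \<Rightarrow> nat" where
  "row_count r j = length (filter (\<lambda>y. y \<le> j) r)"

lemma row_count_Nil [simp]: "row_count [] j = 0"
  and row_count_Cons [simp]: "row_count (y # r) j = (if y \<le> j then Suc (row_count r j) else row_count r j)"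
  by (simp_all add: row_count_def)

lemma row_count_Suc: "row_count r (Suc j) = row_count r j + count (mset r) (Suc j)"
  by (induction r) auto

lemma row_count_mono: "i \<le> j \<Longrightarrow> row_count r i \<le> row_count r j"
  by (induction r) auto

lemma row_count_eq_0: "\<forall>y\<in>set r. j < y \<Longrightarrow> row_count r j = 0"
  by (induction r) auto

lemma row_count_eq_length: "\<forall>y\<in>set r. y \<le> j \<Longrightarrow> row_count r j = length r"
  by (induction r) auto

text \<open>The entries at most \<open>j\<close> are a prefix of a sorted row. This lets counts
  stand for row lengths of sublevel sets.\<close>

lemma sorted_nth_le_iff:
  assumes "sorted r" "c < length r"
  shows "r ! c \<le> j \<longleftrightarrow> c < row_count r j"
  using assms
proof (induction r arbitrary: c)
  case (Cons y r)
  show ?case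
  proof (cases "y \<le> j")
    case True
    then show ?thesis using Cons by (cases c) auto
  next
    case False
    with Cons.prems have "\<forall>z\<in>set (y # r). j < z" by auto
    then have "row_count (y # r) j = 0" "j < (y # r) ! c"
      using row_count_eq_0 Cons.prems(2) nth_mem by blast+
    then show ?thesis by simp
  qed
qed simp

fun bump_row :: "nat list \<Rightarrow> nat list \<Rightarrow> nat list \<times> nat list" where
  "bump_row r [] = (r, [])"
| "bump_row r (x # w) =
     (case row_insert x r of (r1, b) \<Rightarrow>
        (case bump_row r1 w of (r2, w2) \<Rightarrow>
           (r2, case b of None \<Rightarrow> w2 | Some y \<Rightarrow> y # w2)))"

lemma row_insert_mset:
  assumes "row_insert x r = (r1, b)"
  shows "mset r1 + mset (case b of None \<Rightarrow> [] | Some y \<Rightarrow> [y]) = add_mset x (mset r)"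
  using assms
  by (induction r arbitrary: r1) (auto split: if_splits prod.splits option.splits)

text \<open>For \<open>j \<ge> x\<close> the count is unchanged if the bumped entry is at most
  \<open>j\<close>, and grows by one otherwise. A bumped entry at most \<open>j\<close> exists
  exactly when \<open>row_count r x < row_count r j\<close>; the maximum merges the two
  cases.\<close>

lemma row_insert_row_count:
  assumes "sorted r" "row_insert x r = (r1, b)"
  shows "row_count r1 j = (if j < x then row_count r j else max (Suc (row_count r x)) (row_count r j))"
  using assms
proof (induction r arbitrary: r1)
  case (Cons y r)
  show ?case
  proof (cases "x < y")
    case True
    have "row_count r i = 0" if "i < y" for i
      using that Cons.prems(1) by (intro row_count_eq_0) auto
    then show ?thesis using True Cons.prems by auto
  next
    case False
    obtain r2 where r2: "row_insert x r = (r2, b)" "r1 = y # r2"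
      using Cons.prems(2) False by (auto split: prod.splits)
    show ?thesis
      using Cons.IH[OF _ r2(1)] Cons.prems(1) False r2(2) by auto
  qed
qed auto

lemma row_insert_sorted:
  assumes "sorted r" "row_insert x r = (r1, b)"
  shows "sorted r1"
  using assms
proof (induction r arbitrary: r1)
  case (Cons y r)
  show ?case
  proof (cases "x < y")
    case True
    then show ?thesis using Cons.prems by fastforce
  next
    case False
    obtain r2 where r2: "row_insert x r = (r2, b)" "r1 = y # r2"
      using Cons.prems(2) False by (auto split: prod.splits)
    have "set_mset (mset r2) \<subseteq> insert x (set r)"
      using row_insert_mset[OF r2(1)]
      by (metis mset_subset_eq_add_left set_mset_add_mset_insert set_mset_mono set_mset_mset)
    then show ?thesis
      using Cons.IH[OF _ r2(1)] Cons.prems(1) False r2(2) by auto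
  qed
qed auto

lemma row_insert_bumped:
  assumes "row_insert x r = (r1, Some y)"
  shows "x < y" "y \<in> set r"
  using assms by (induction r arbitrary: r1) (auto split: if_splits prod.splits)

lemma row_insert_bumped_least:
  assumes "sorted r" "row_insert x r = (r1, Some y)" "e \<in> set r1" "x < e"
  shows "y \<le> e"
  using assms by (induction r arbitrary: r1) (auto split: if_splits prod.splits)

lemma row_insert_append:
  "\<forall>y\<in>set r. y \<le> x \<Longrightarrow> row_insert x r = (r @ [x], None)"
  by (induction r) auto

lemma row_insert_length:
  "row_insert x r = (r1, b) \<Longrightarrow> length r1 = (case b of None \<Rightarrow> Suc (length r) | Some _ \<Rightarrow> length r)"
  by (induction r arbitrary: r1) (auto split: if_splits prod.splits option.splits)

lemma bump_row_append: "sorted (r @ w) \<Longrightarrow> bump_row r w = (r @ w, [])"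
proof (induction w arbitrary: r)
  case (Cons x w)
  have "row_insert x r = (r @ [x], None)"
    using Cons.prems by (intro row_insert_append) (auto simp: sorted_append)
  then show ?case using Cons.IH[of "r @ [x]"] Cons.prems by simp
qed simp

lemma bump_row_mset:
  "bump_row r w = (r', w') \<Longrightarrow> mset r' + mset w' = mset r + mset w"
proof (induction w arbitrary: r r' w')
  case (Cons x w)
  obtain r1 b w2 where *: "row_insert x r = (r1, b)" "bump_row r1 w = (r', w2)"
    "w' = (case b of None \<Rightarrow> w2 | Some y \<Rightarrow> y # w2)"
    using Cons.prems by (auto split: prod.splits)
  show ?case
    using row_insert_mset[OF *(1)] Cons.IH[OF *(2)] *(3)
    by (auto split: option.splits)
qed simp

lemma bump_row_sorted:
  "bump_row r w = (r', w') \<Longrightarrow> sorted r \<Longrightarrow> sorted r'"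
  by (induction w arbitrary: r r' w') (auto split: prod.splits dest: row_insert_sorted)

lemma bump_row_length: "bump_row r w = (r', w') \<Longrightarrow> length r \<le> length r'"
proof (induction w arbitrary: r r' w')
  case (Cons x w)
  obtain r1 b w2 where *: "row_insert x r = (r1, b)" "bump_row r1 w = (r', w2)"
    using Cons.prems by (auto split: prod.splits)
  show ?case
    using row_insert_length[OF *(1)] Cons.IH[OF *(2)] by (auto split: option.splits)
qed simp

text \<open>An invariant for the sortedness of the bumped word. Later letters are at least
  \<open>x\<close>, so they bump only entries above \<open>x\<close>. An entry above the current
  letter was already in the old row, so the bound \<open>y\<close> survives each insertion.\<close>

lemma bump_row_bumped_ge:
  assumes "bump_row r w = (r', w')" "sorted r" "sorted (x # w)" "\<forall>e\<in>set r. x < e \<longrightarrow> y \<le> e"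
  shows "\<forall>z\<in>set w'. y \<le> z"
  using assms
proof (induction w arbitrary: r r' w' x)
  case (Cons x2 w)
  obtain r1 b w2 where *: "row_insert x2 r = (r1, b)" "bump_row r1 w = (r', w2)"
    "w' = (case b of None \<Rightarrow> w2 | Some y \<Rightarrow> y # w2)"
    using Cons.prems by (auto split: prod.splits)
  have sub: "set r1 \<subseteq> insert x2 (set r)"
    using row_insert_mset[OF *(1)]
    by (metis mset_subset_eq_add_left set_mset_add_mset_insert set_mset_mono set_mset_mset)
  have "\<forall>z\<in>set w2. y \<le> z"
    using Cons.IH[OF *(2) row_insert_sorted[OF Cons.prems(2) *(1)], of x2] Cons.prems(3,4) sub
    by fastforce
  moreover have "y \<le> z" if "b = Some z" for z
    using row_insert_bumped[of x2 r r1 z] * that Cons.prems(3,4) by auto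
  ultimately show ?case using *(3) by (auto split: option.splits)
qed simp

lemma bump_row_bumped_sorted:
  assumes "bump_row r w = (r', w')" "sorted r" "sorted w"
  shows "sorted w'"
  using assms
proof (induction w arbitrary: r r' w')
  case (Cons x w)
  obtain r1 b w2 where *: "row_insert x r = (r1, b)" "bump_row r1 w = (r', w2)"
    "w' = (case b of None \<Rightarrow> w2 | Some y \<Rightarrow> y # w2)"
    using Cons.prems by (auto split: prod.splits)
  have s1: "sorted r1" using row_insert_sorted[OF Cons.prems(2) *(1)] .
  have "sorted w2" using Cons.IH[OF *(2) s1] Cons.prems(3) by simp
  \<comment> \<open>The first bumped letter \<open>y\<close> is the least entry above
    \<open>x\<close>; what remains above \<open>x\<close> in \<open>r1\<close> is at least
    \<open>y\<close>, and so is everything bumped later.\<close>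
  moreover have "\<forall>z\<in>set w2. y \<le> z" if "b = Some y" for y
    using bump_row_bumped_ge[OF *(2) s1 Cons.prems(3)] that *(1)
      row_insert_bumped_least[OF Cons.prems(2)] by blast
  ultimately show ?case using *(3) by (auto split: option.splits)
qed simp

lemma bump_row_row_count_less:
  assumes "bump_row r w = (r', w')" "sorted r" "\<forall>x\<in>set w. j < x"
  shows "row_count r' j = row_count r j"
  using assms
proof (induction w arbitrary: r r' w')
  case (Cons x w)
  obtain r1 b w2 where *: "row_insert x r = (r1, b)" "bump_row r1 w = (r', w2)"
    using Cons.prems by (auto split: prod.splits)
  show ?case
    using Cons.IH[OF *(2) row_insert_sorted[OF Cons.prems(2) *(1)]]
      row_insert_row_count[OF Cons.prems(2) *(1), of j] Cons.prems(3) by auto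
qed simp

lemma bump_row_row_count_ge:
  assumes "bump_row r w = (r', w')" "sorted r"
  shows "row_count r j \<le> row_count r' j"
  using assms
proof (induction w arbitrary: r r' w')
  case (Cons x w)
  obtain r1 b w2 where *: "row_insert x r = (r1, b)" "bump_row r1 w = (r', w2)"
    using Cons.prems by (auto split: prod.splits)
  show ?case
    using Cons.IH[OF *(2) row_insert_sorted[OF Cons.prems(2) *(1)]]
      row_insert_row_count[OF Cons.prems(2) *(1), of j] by (auto split: if_splits)
qed simp

text \<open>Letters at most \<open>j\<close> raise the count up to \<open>Suc j\<close> only once no
  entry \<open>Suc j\<close> is left to bump, which gives the maximum; each letter
  \<open>Suc j\<close> then adds one, and larger letters change nothing.\<close>

lemma bump_row_row_count:
  assumes "bump_row r w = (r', w')" "sorted r" "sorted w"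
  shows "row_count r' (Suc j) = max (row_count r' j) (row_count r (Suc j)) + count (mset w) (Suc j)"
  using assms
proof (induction w arbitrary: r r' w')
  case Nil
  then show ?case using row_count_mono[of j "Suc j" r] by auto
next
  case (Cons x w)
  obtain r1 b w2 where *: "row_insert x r = (r1, b)" "bump_row r1 w = (r', w2)"
    using Cons.prems by (auto split: prod.splits)
  have s1: "sorted r1" using row_insert_sorted[OF Cons.prems(2) *(1)] .
  have IH: "row_count r' (Suc i) = max (row_count r' i) (row_count r1 (Suc i)) + count (mset w) (Suc i)"
    if "i = j" for i
    using Cons.IH[OF *(2) s1] Cons.prems(3) that by simp
  note r1 = row_insert_row_count[OF Cons.prems(2) *(1)]
  consider "Suc j < x" | "Suc j = x" | "x \<le> j" by linarith
  then show ?case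
  proof cases
    case 1
    then show ?thesis using IH r1[of "Suc j"] by simp
  next
    case 2
    have "row_count r' j = row_count r j"
      using bump_row_row_count_less[OF Cons.prems(1,2), of j] Cons.prems(3) 2 by (auto simp: Suc_le_eq)
    then show ?thesis
      using IH r1[of "Suc j"] 2 row_count_mono[of j "Suc j" r] by auto
  next
    case 3
    \<comment> \<open>The first letter brings the term \<open>Suc (row_count r x)\<close> into the
      maximum. It equals \<open>row_count r1 x\<close>, so \<open>row_count r' j\<close> absorbs
      it.\<close>
    have "row_count r1 x \<le> row_count r' x"
      using bump_row_row_count_ge[OF *(2) s1] .
    also have "\<dots> \<le> row_count r' j" using 3 by (rule row_count_mono)
    finally show ?thesis using IH r1[of "Suc j"] r1[of x] 3 by auto
  qed
qed

text \<open>Conservation of letters: the copies of \<open>Suc j\<close> in the row and in the word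
  are shared between the new row and the bumped word. As maximum plus minimum is the sum, the
  maximum of \<open>bump_row_row_count\<close> turns into a minimum.\<close>

lemma bump_row_bumped_count:
  assumes "bump_row r w = (r', w')" "sorted r" "sorted w"
  shows "count (mset w') (Suc j) = min (row_count r' j) (row_count r (Suc j)) - row_count r j"
proof -
  have "count (mset r') (Suc j) + count (mset w') (Suc j) = count (mset r) (Suc j) + count (mset w) (Suc j)"
    using bump_row_mset[OF assms(1)] by (metis count_union)
  then show ?thesis
    using bump_row_row_count[OF assms, of j] row_count_Suc[of r j] row_count_Suc[of r' j]
    by (auto simp: max_def min_def split: if_splits)
qed

section \<open>Inserting a word into a whole tableau\<close>

definition tab_row :: "tableau \<Rightarrow> nat \<Rightarrow> nat list" where
  "tab_row T i = (if i < length T then T ! i else [])"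

lemma tab_row_Nil [simp]: "tab_row [] i = []"
  and tab_row_Cons_0 [simp]: "tab_row (r # T) 0 = r"
  and tab_row_Cons_Suc [simp]: "tab_row (r # T) (Suc i) = tab_row T i"
  by (simp_all add: tab_row_def)

text \<open>The rows below see only the sequence of bumped letters, so the insertions can be
  reordered: the whole word passes through the first row, then the bumped word through the rest.
  Every letter that bumps nothing lengthens the first row by one label \<open>a\<close>.\<close>

lemma fold_rsk_insert_Cons:
  assumes "bump_row r w = (r', w')" "fold (rsk_insert a) w' (L, R) = (L', R')"
  shows "fold (rsk_insert a) w (r # L, q # R) = (r' # L', (q @ replicate (length r' - length r) a) # R')"
  using assms
proof (induction w arbitrary: r q w' L R)
  case (Cons x w)
  obtain r1 b w2 where *: "row_insert x r = (r1, b)" "bump_row r1 w = (r', w2)"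
    "w' = (case b of None \<Rightarrow> w2 | Some y \<Rightarrow> y # w2)"
    using Cons.prems by (auto split: prod.splits)
  have len: "length r1 \<le> length r'" using bump_row_length[OF *(2)] .
  show ?case
  proof (cases b)
    case None
    have "replicate (length r' - length r) a = a # replicate (length r' - length r1) a"
      using len row_insert_length[OF *(1)] None
      by (metis Suc_diff_Suc Suc_le_lessD option.simps(4) replicate_Suc)
    then show ?thesis using Cons.IH[OF *(2)] Cons.prems(2) * None by simp
  next
    case (Some y)
    obtain L1 R1 where "rsk_insert a y (L, R) = (L1, R1)" by fastforce
    then show ?thesis
      using Cons.IH[OF *(2), of L1 R1] Cons.prems(2) * Some row_insert_length[OF *(1)] by simp
  qed
qed simp

lemma fold_rsk_insert_Nil:
  assumes "sorted w" "w \<noteq> []"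
  shows "fold (rsk_insert a) w ([], []) = ([w], [replicate (length w) a])"
proof -
  obtain x v where w: "w = x # v" using assms(2) by (cases w) auto
  have "bump_row [x] v = (w, [])" using bump_row_append[of "[x]" v] assms(1) w by simp
  from fold_rsk_insert_Cons[OF this, of a "[]" "[]" "[]" "[]" "[a]"]
  show ?thesis using w by simp
qed

definition row_sorted :: "nat \<Rightarrow> tableau \<Rightarrow> bool" where
  "row_sorted k L \<longleftrightarrow> (\<forall>r\<in>set L. sorted r \<and> set r \<subseteq> {1..k})"

lemma row_sorted_tab_row: "row_sorted k L \<Longrightarrow> sorted (tab_row L i) \<and> set (tab_row L i) \<subseteq> {1..k}"
  by (auto simp: row_sorted_def tab_row_def)

text \<open>Row \<open>i\<close> receives the letters bumped from row \<open>i - 1\<close>, with the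
  multiplicities of \<open>bump_row_bumped_count\<close>. The bumped word is again sorted, which
  allows an induction over the rows.\<close>

lemma fold_rsk_insert:
  assumes "sorted w" "set w \<subseteq> {1..k}" "row_sorted k L" "map length L = map length R"
    "fold (rsk_insert a) w (L, R) = (L', R')"
  shows "row_sorted k L'" "map length L' = map length R'"
    "\<exists>d. tab_row R' i = tab_row R i @ replicate d a"
    "row_count (tab_row L' i) (Suc j) = max (row_count (tab_row L' i) j) (row_count (tab_row L i) (Suc j)) +
       (case i of 0 \<Rightarrow> count (mset w) (Suc j)
        | Suc i' \<Rightarrow> min (row_count (tab_row L' i') j) (row_count (tab_row L i') (Suc j))
                      - row_count (tab_row L i') j)"
proof -
  have "row_sorted k L' \<and> map length L' = map length R' \<and> (\<forall>i.
    (\<exists>d. tab_row R' i = tab_row R i @ replicate d a) \<and> (\<forall>j.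
    row_count (tab_row L' i) (Suc j) = max (row_count (tab_row L' i) j) (row_count (tab_row L i) (Suc j)) +
       (case i of 0 \<Rightarrow> count (mset w) (Suc j)
        | Suc i' \<Rightarrow> min (row_count (tab_row L' i') j) (row_count (tab_row L i') (Suc j))
                      - row_count (tab_row L i') j)))"
    using assms
  proof (induction L arbitrary: w R L' R')
    case Nil
    show ?case
    proof (cases "w = []")
      case True
      then show ?thesis using Nil by (auto simp: row_sorted_def split: nat.splits)
    next
      case False
      then have eq: "L' = [w]" "R' = [replicate (length w) a]"
        using Nil fold_rsk_insert_Nil by auto
      have "tab_row R' i = tab_row R i @ replicate (if i = 0 then length w else 0) a" for i
        using eq Nil by (cases i) auto
      moreover have "row_count w (Suc j) = row_count w j + count (mset w) (Suc j)" for j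
        by (rule row_count_Suc)
      ultimately show ?thesis
        using eq Nil by (auto simp: row_sorted_def split: nat.splits)
    qed
  next
    case (Cons r L)
    obtain q R0 where R: "R = q # R0" "length r = length q" "map length L = map length R0"
      using Cons.prems(4) by (cases R) auto
    obtain r' w' where b: "bump_row r w = (r', w')" by fastforce
    obtain L1 R1 where f: "fold (rsk_insert a) w' (L, R0) = (L1, R1)" by fastforce
    have eq: "L' = r' # L1" "R' = (q @ replicate (length r' - length r) a) # R1"
      using fold_rsk_insert_Cons[OF b f] Cons.prems(5) R by auto
    have sr: "sorted r" "set r \<subseteq> {1..k}" "row_sorted k L" using Cons.prems(3) by (auto simp: row_sorted_def)
    have "set r' \<union> set w' = set r \<union> set w"
      using bump_row_mset[OF b] by (metis set_mset_mset set_mset_union)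
    then have sub: "set r' \<subseteq> {1..k}" "set w' \<subseteq> {1..k}" using sr Cons.prems(2) by auto
    have sr': "sorted r'" "sorted w'"
      using bump_row_sorted[OF b] bump_row_bumped_sorted[OF b] sr Cons.prems(1) by auto
    note IH = Cons.IH[OF sr'(2) sub(2) sr(3) R(3) f]
    note cnt = bump_row_row_count[OF b sr(1) Cons.prems(1)] bump_row_bumped_count[OF b sr(1) Cons.prems(1)]
    have len: "length r \<le> length r'" using bump_row_length[OF b] .
    show ?case
    proof (intro conjI allI)
      show "row_sorted k L'" using IH eq sub sr' by (auto simp: row_sorted_def)
      show "map length L' = map length R'" using IH eq R len by simp
      fix i
      show "\<exists>d. tab_row R' i = tab_row R i @ replicate d a"
        using IH eq R by (cases i) auto
      fix j
      show "row_count (tab_row L' i) (Suc j) = max (row_count (tab_row L' i) j) (row_count (tab_row (r # L) i) (Suc j)) +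
       (case i of 0 \<Rightarrow> count (mset w) (Suc j)
        | Suc i' \<Rightarrow> min (row_count (tab_row L' i') j) (row_count (tab_row (r # L) i') (Suc j))
                      - row_count (tab_row (r # L) i') j)"
      proof (cases i)
        case 0
        then show ?thesis using cnt(1) eq by simp
      next
        case (Suc i')
        \<comment> \<open>For \<open>i' = 0\<close> the word entering the row is \<open>w'\<close>,
          counted by \<open>cnt(2)\<close>; deeper rows are the induction hypothesis for
          \<open>w'\<close>.\<close>
        then show ?thesis using IH eq cnt(2) by (cases i') auto
      qed
    qed
  qed
  then show "row_sorted k L'" "map length L' = map length R'"
    "\<exists>d. tab_row R' i = tab_row R i @ replicate d a"
    "row_count (tab_row L' i) (Suc j) = max (row_count (tab_row L' i) j) (row_count (tab_row L i) (Suc j)) +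
       (case i of 0 \<Rightarrow> count (mset w) (Suc j)
        | Suc i' \<Rightarrow> min (row_count (tab_row L' i') j) (row_count (tab_row L i') (Suc j))
                      - row_count (tab_row L i') j)"
    by blast+
qed

section \<open>The tableaux after each row of the matrix\<close>

text \<open>\<open>growth A i j r\<close> is the length of row \<open>r\<close> (counted from 0) of the insertion tableau after the
  first \<open>i\<close> rows of \<open>A\<close>, restricted to entries \<open>\<le> j\<close>. The subtraction never truncates, by
  \<open>growth_interlaces\<close> below.\<close>

fun growth :: "(nat \<Rightarrow> nat \<Rightarrow> nat) \<Rightarrow> nat \<Rightarrow> nat \<Rightarrow> nat \<Rightarrow> nat" where
  "growth A 0 j r = 0"
| "growth A (Suc i) 0 r = 0"
| "growth A (Suc i) (Suc j) r =
     max (growth A i (Suc j) r) (growth A (Suc i) j r) +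
     (case r of 0 \<Rightarrow> A (Suc i) (Suc j)
      | Suc r' \<Rightarrow> min (growth A i (Suc j) r') (growth A (Suc i) j r') - growth A i j r')"

definition rsk_stage :: "nat \<Rightarrow> (nat \<Rightarrow> nat \<Rightarrow> nat) \<Rightarrow> nat \<Rightarrow> tableau \<times> tableau" where
  "rsk_stage k A n = fold (\<lambda>i. fold (rsk_insert i)
     (concat (map (\<lambda>j. replicate (A i j) j) [1..<Suc k]))) [1..<Suc n] ([], [])"

lemma fold_concat: "fold f (concat xss) s = fold (fold f) xss s"
  by (induction xss arbitrary: s) auto

lemma fold_map_apply: "fold f (map g xs) s = fold (\<lambda>x. f (g x)) xs s"
  by (simp add: fold_map comp_def)

lemma rsk_eq_rsk_stage: "rsk k A = rsk_stage k A k"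
proof -
  have "fold (\<lambda>(i, j). rsk_insert i j) (replicate c (i, j)) = fold (rsk_insert i) (replicate c j)"
    for i j c
    by (induction c) auto
  then show ?thesis
    unfolding rsk_def generalized_permutation_def rsk_stage_def fold_concat fold_map_apply by presburger
qed

lemma stage_word_sorted:
  "sorted (concat (map (\<lambda>j. replicate (f j) j) [1..<Suc k]))"
  by (induction k) (auto simp: sorted_append)

lemma stage_word_count:
  "count (mset (concat (map (\<lambda>j. replicate (f j) j) [1..<Suc k]))) x = (if 1 \<le> x \<and> x \<le> k then f x else 0)"
  by (induction k) (auto simp: le_Suc_eq)

lemma rsk_stage_0 [simp]: "rsk_stage k A 0 = ([], [])"
  by (simp add: rsk_stage_def)

lemma rsk_stage_Suc:
  "rsk_stage k A (Suc n) =
     fold (rsk_insert (Suc n)) (concat (map (\<lambda>j. replicate (A (Suc n) j) j) [1..<Suc k])) (rsk_stage k A n)"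
  by (simp add: rsk_stage_def)

lemma rsk_stage_invariant:
  "row_sorted k (fst (rsk_stage k A n)) \<and> map length (fst (rsk_stage k A n)) = map length (snd (rsk_stage k A n))"
proof (induction n)
  case (Suc n)
  obtain L R where LR: "rsk_stage k A n = (L, R)" by fastforce
  obtain L' R' where LR': "rsk_stage k A (Suc n) = (L', R')" by fastforce
  let ?w = "concat (map (\<lambda>j. replicate (A (Suc n) j) j) [1..<Suc k])"
  have "set ?w \<subseteq> {1..k}" by auto
  from fold_rsk_insert(1,2)[OF stage_word_sorted this, of L R "Suc n" L' R'] Suc LR LR'
  show ?case by (simp add: rsk_stage_Suc)
qed (simp add: row_sorted_def)

lemma
  shows row_count_rsk_stage_Suc: "row_count (tab_row (fst (rsk_stage k A (Suc n))) i) (Suc j) =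
      max (row_count (tab_row (fst (rsk_stage k A (Suc n))) i) j) (row_count (tab_row (fst (rsk_stage k A n)) i) (Suc j)) +
       (case i of 0 \<Rightarrow> if j < k then A (Suc n) (Suc j) else 0
        | Suc i' \<Rightarrow> min (row_count (tab_row (fst (rsk_stage k A (Suc n))) i') j) (row_count (tab_row (fst (rsk_stage k A n)) i') (Suc j))
                      - row_count (tab_row (fst (rsk_stage k A n)) i') j)" (is ?A)
  and recording_rsk_stage_Suc: "\<exists>d. tab_row (snd (rsk_stage k A (Suc n))) i = tab_row (snd (rsk_stage k A n)) i @ replicate d (Suc n)"
    (is ?B)
proof -
  obtain L R where LR: "rsk_stage k A n = (L, R)" by fastforce
  obtain L' R' where LR': "rsk_stage k A (Suc n) = (L', R')" by fastforce
  let ?w = "concat (map (\<lambda>j. replicate (A (Suc n) j) j) [1..<Suc k])"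
  have w: "set ?w \<subseteq> {1..k}" by auto
  have c: "count (mset ?w) (Suc j) = (if j < k then A (Suc n) (Suc j) else 0)"
    unfolding stage_word_count by auto
  have inv: "row_sorted k L" "map length L = map length R" using rsk_stage_invariant[of k A n] LR by auto
  have f: "fold (rsk_insert (Suc n)) ?w (L, R) = (L', R')" using LR' LR rsk_stage_Suc[of k A n] by simp
  from fold_rsk_insert(3)[OF stage_word_sorted w inv f, of i] fold_rsk_insert(4)[OF stage_word_sorted w inv f, of i j]
  show ?A ?B unfolding LR LR' c fst_conv snd_conv by blast+
qed

lemma row_count_0:
  "row_sorted k L \<Longrightarrow> row_count (tab_row L i) 0 = 0"
  using row_sorted_tab_row[of k L i] by (intro row_count_eq_0) auto

text \<open>Both sides vanish on the edges and obey the same recursion, which refers back in both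
  directions; hence the nested induction. The bound \<open>j \<le> k\<close> reflects that the
  inserted words stop at letter \<open>k\<close>, whereas \<open>growth\<close> reads the matrix
  beyond it.\<close>

lemma growth_eq_row_count:
  "j \<le> k \<Longrightarrow> row_count (tab_row (fst (rsk_stage k A n)) i) j = growth A n j i"
proof (induction n arbitrary: j i)
  case (Suc n)
  note IHn = Suc.IH
  show ?case using Suc.prems
  proof (induction j arbitrary: i)
    case 0
    then show ?case using row_count_0[of k] rsk_stage_invariant[of k] by simp
  next
    case (Suc j)
    show ?case
      unfolding row_count_rsk_stage_Suc using Suc.IH IHn Suc.prems
      by (auto split: nat.splits)
  qed
qed simp

text \<open>Labels are only appended, in increasing order, so a row at stage \<open>n\<close> is
  exactly the part of the later row with labels at most \<open>n\<close>.\<close>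

lemma recording_rsk_stage:
  "set (tab_row (snd (rsk_stage k A n)) i) \<subseteq> {1..n}"
  "n \<le> l \<Longrightarrow> \<exists>v. tab_row (snd (rsk_stage k A l)) i = tab_row (snd (rsk_stage k A n)) i @ v \<and> (\<forall>x\<in>set v. n < x)"
proof -
  show "set (tab_row (snd (rsk_stage k A n)) i) \<subseteq> {1..n}"
  proof (induction n)
    case (Suc n)
    obtain d where "tab_row (snd (rsk_stage k A (Suc n))) i = tab_row (snd (rsk_stage k A n)) i @ replicate d (Suc n)"
      using recording_rsk_stage_Suc by blast
    then show ?case using Suc by auto
  qed simp
  show "\<exists>v. tab_row (snd (rsk_stage k A l)) i = tab_row (snd (rsk_stage k A n)) i @ v \<and> (\<forall>x\<in>set v. n < x)" if "n \<le> l"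
    using that
  proof (induction l rule: dec_induct)
    case (step l)
    obtain d where d: "tab_row (snd (rsk_stage k A (Suc l))) i = tab_row (snd (rsk_stage k A l)) i @ replicate d (Suc l)"
      using recording_rsk_stage_Suc by blast
    obtain v where "tab_row (snd (rsk_stage k A l)) i = tab_row (snd (rsk_stage k A n)) i @ v" "\<forall>x\<in>set v. n < x"
      using step by blast
    then show ?case using d step.hyps by (intro exI[of _ "v @ replicate d (Suc l)"]) auto
  qed auto
qed

text \<open>Boxes are numbered from 1, but the rows of \<open>p\<close> from 0.\<close>

definition diagram :: "(nat \<Rightarrow> nat) \<Rightarrow> box set" where
  "diagram p = {(i, j). 1 \<le> i \<and> 1 \<le> j \<and> j \<le> p (i - 1)}"

lemma shape_eq_diagram: "shape T = diagram (\<lambda>i. length (tab_row T i))"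
proof -
  have "j \<le> length (tab_row T (i - 1)) \<longleftrightarrow> i \<le> length T \<and> j \<le> length (T ! (i - 1))"
    if "1 \<le> i" "1 \<le> j" for i j
    using that by (auto simp: tab_row_def)
  then show ?thesis unfolding shape_def diagram_def by blast
qed

lemma entry_eq: "(i, j) \<in> shape T \<Longrightarrow> entry T (i, j) = tab_row T (i - 1) ! (j - 1)"
  by (auto simp: shape_def entry_def tab_row_def)

lemma length_tab_row_cong: "map length L = map length R \<Longrightarrow> length (tab_row L i) = length (tab_row R i)"
  by (auto simp: tab_row_def list_eq_iff_nth_eq)

lemma growth_eq_length:
  shows "growth A n k i = length (tab_row (fst (rsk_stage k A n)) i)"
    and "growth A n k i = length (tab_row (snd (rsk_stage k A n)) i)"
proof -
  let ?L = "fst (rsk_stage k A n)"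
  have inv: "row_sorted k ?L" "map length ?L = map length (snd (rsk_stage k A n))"
    using rsk_stage_invariant by auto
  have "growth A n k i = row_count (tab_row ?L i) k" by (simp add: growth_eq_row_count)
  also have "\<dots> = length (tab_row ?L i)"
    using row_sorted_tab_row[OF inv(1), of i] by (intro row_count_eq_length) auto
  finally show "growth A n k i = length (tab_row ?L i)"
    "growth A n k i = length (tab_row (snd (rsk_stage k A n)) i)"
    using length_tab_row_cong[OF inv(2)] by simp_all
qed

lemma shape_rsk:
  "shape (fst (rsk k A)) = diagram (growth A k k)" "shape (snd (rsk k A)) = diagram (growth A k k)"
  by (simp_all add: shape_eq_diagram rsk_eq_rsk_stage flip: growth_eq_length)

lemma insertion_sublevel:
  assumes "j \<le> k"
  shows "{b \<in> shape (fst (rsk k A)). entry (fst (rsk k A)) b \<le> j} = diagram (growth A k j)"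
proof -
  let ?L = "fst (rsk k A)"
  have rs: "row_sorted k ?L" using rsk_stage_invariant[of k A k] by (simp add: rsk_eq_rsk_stage)
  have g: "growth A k j i = row_count (tab_row ?L i) j" for i
    using growth_eq_row_count[OF assms] by (simp add: rsk_eq_rsk_stage)
  have le: "row_count (tab_row ?L i) j \<le> length (tab_row ?L i)" for i
    by (simp add: row_count_def)
  have "entry ?L (i, c) \<le> j \<longleftrightarrow> c \<le> growth A k j (i - 1)" if "(i, c) \<in> shape ?L" for i c
  proof -
    have "c - 1 < length (tab_row ?L (i - 1))" "1 \<le> c" using that by (auto simp: shape_eq_diagram diagram_def)
    then show ?thesis
      using sorted_nth_le_iff[of "tab_row ?L (i - 1)" "c - 1" j] row_sorted_tab_row[OF rs] entry_eq[OF that] g by auto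
  qed
  moreover have "(i, c) \<in> shape ?L" if "(i, c) \<in> diagram (growth A k j)" for i c
    using that g[of "i - 1"] le[of "i - 1"] by (auto simp: shape_eq_diagram diagram_def)
  moreover have "(i, c) \<in> diagram (growth A k j) \<longleftrightarrow> c \<le> growth A k j (i - 1)" if "(i, c) \<in> shape ?L" for i c
    using that by (auto simp: shape_def diagram_def)
  ultimately have "(i, c) \<in> {b \<in> shape ?L. entry ?L b \<le> j} \<longleftrightarrow> (i, c) \<in> diagram (growth A k j)" for i c
    by blast
  then show ?thesis by (simp only: set_eq_iff split_paired_All) simp
qed

lemma recording_sublevel:
  assumes "j \<le> k"
  shows "{b \<in> shape (snd (rsk k A)). entry (snd (rsk k A)) b \<le> j} = diagram (growth A j k)"
proof -
  let ?R = "snd (rsk k A)"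
  note g = growth_eq_length(2)[of A j k]
  have "entry ?R (i, c) \<le> j \<longleftrightarrow> c \<le> growth A j k (i - 1)" if "(i, c) \<in> shape ?R" for i c
  proof -
    let ?u = "tab_row (snd (rsk_stage k A j)) (i - 1)"
    obtain v where v: "tab_row ?R (i - 1) = ?u @ v" "\<forall>x\<in>set v. j < x"
      using recording_rsk_stage(2)[OF assms, of k A "i - 1"] by (auto simp: rsk_eq_rsk_stage)
    have "c - 1 < length (tab_row ?R (i - 1))" "1 \<le> c" using that by (auto simp: shape_eq_diagram diagram_def)
    moreover have "\<forall>x\<in>set ?u. x \<le> j"
      using recording_rsk_stage(1)[of k A j "i - 1"] by auto
    ultimately have "(?u @ v) ! (c - 1) \<le> j \<longleftrightarrow> c - 1 < length ?u"
      using v nth_mem[of "c - 1" ?u] nth_mem[of "c - 1 - length ?u" v]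
      by (cases "c - 1 < length ?u") (simp_all add: nth_append not_le)
    then show ?thesis using \<open>1 \<le> c\<close> unfolding entry_eq[OF that] v(1) g by linarith
  qed
  moreover have "(i, c) \<in> shape ?R" if c: "(i, c) \<in> diagram (growth A j k)" for i c
  proof -
    obtain v where v: "tab_row ?R (i - 1) = tab_row (snd (rsk_stage k A j)) (i - 1) @ v"
      using recording_rsk_stage(2)[OF assms, of k A "i - 1"] by (auto simp: rsk_eq_rsk_stage)
    then show ?thesis using c g[of "i - 1"] by (auto simp: shape_eq_diagram diagram_def)
  qed
  moreover have "(i, c) \<in> diagram (growth A j k) \<longleftrightarrow> c \<le> growth A j k (i - 1)" if "(i, c) \<in> shape ?R" for i c
    using that by (auto simp: shape_def diagram_def)
  ultimately have "(i, c) \<in> {b \<in> shape ?R. entry ?R b \<le> j} \<longleftrightarrow> (i, c) \<in> diagram (growth A j k)" for i c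
    by blast
  then show ?thesis by (simp only: set_eq_iff split_paired_All) simp
qed

section \<open>The local growth rule\<close>

text \<open>The boxes between \<open>p\<close> and \<open>q\<close> form a horizontal strip: no two
  share a column. The condition also forces both sequences to decrease weakly, so monotonicity is
  not carried separately.\<close>

definition interlaces :: "(nat \<Rightarrow> nat) \<Rightarrow> (nat \<Rightarrow> nat) \<Rightarrow> bool" where
  "interlaces p q \<longleftrightarrow> (\<forall>r. p r \<le> q r \<and> q (Suc r) \<le> p r)"

text \<open>Fomin's local rule: in a square of the growth diagram, \<open>l\<close> is the corner closest to the origin,
  \<open>m\<close> and \<open>n\<close> are its neighbours, and \<open>a\<close> is the matrix entry in the square.\<close>

definition local_rule :: "(nat \<Rightarrow> nat) \<Rightarrow> (nat \<Rightarrow> nat) \<Rightarrow> (nat \<Rightarrow> nat) \<Rightarrow> nat \<Rightarrow> nat \<Rightarrow> nat" where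
  "local_rule l m n a r =
     max (m r) (n r) + (case r of 0 \<Rightarrow> a | Suc r' \<Rightarrow> min (m r') (n r') - l r')"

text \<open>This is \<open>local_rule\<close> in row \<open>Suc r\<close>, solved for
  \<open>l r\<close>. The matrix entry occurs only in row 0 and is recovered by
  \<open>local_rule_0\<close>.\<close>

definition local_inverse :: "(nat \<Rightarrow> nat) \<Rightarrow> (nat \<Rightarrow> nat) \<Rightarrow> (nat \<Rightarrow> nat) \<Rightarrow> nat \<Rightarrow> nat" where
  "local_inverse p m n r = min (m r) (n r) - (p (Suc r) - max (m (Suc r)) (n (Suc r)))"

lemma growth_Suc_Suc:
  "growth A (Suc i) (Suc j) =
     local_rule (growth A i j) (growth A i (Suc j)) (growth A (Suc i) j) (A (Suc i) (Suc j))"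
  by (rule ext) (simp add: local_rule_def growth.simps(3))

declare growth.simps(3) [simp del]

lemma growth_0 [simp]: "growth A 0 j = (\<lambda>_. 0)" "growth A i 0 = (\<lambda>_. 0)"
  by (auto simp: fun_eq_iff) (cases i; simp)

lemma interlaces_zero: "interlaces (\<lambda>_. 0) (\<lambda>_. 0)"
  by (simp add: interlaces_def)

text \<open>The maximum makes rows grow. For the other half,
  \<open>max (m (Suc r)) (n (Suc r)) \<le> l r\<close>, so what the rule adds to this maximum cannot
  lift it above \<open>min (m r) (n r)\<close>.\<close>

lemma local_rule_interlaces:
  assumes "interlaces l m" "interlaces l n"
  shows "interlaces m (local_rule l m n a)" "interlaces n (local_rule l m n a)"
proof -
  have "local_rule l m n a (Suc r) \<le> min (m r) (n r)" for r
  proof -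
    have "max (m (Suc r)) (n (Suc r)) \<le> l r" "l r \<le> min (m r) (n r)"
      using assms by (auto simp: interlaces_def)
    moreover have "a + (b - c) \<le> b" if "a \<le> c" "c \<le> b" for a b c :: nat
      using that by simp
    ultimately show ?thesis unfolding local_rule_def nat.case by blast
  qed
  then show "interlaces m (local_rule l m n a)" "interlaces n (local_rule l m n a)"
    by (auto simp: interlaces_def) (simp_all add: local_rule_def)
qed

lemma local_inverse_local_rule:
  assumes "interlaces l m" "interlaces l n"
  shows "local_inverse (local_rule l m n a) m n = l"
proof
  fix r
  have "l r \<le> min (m r) (n r)" using assms by (auto simp: interlaces_def)
  then show "local_inverse (local_rule l m n a) m n r = l r"
    by (simp add: local_inverse_def local_rule_def)
qed

lemma local_rule_0: "local_rule l m n a 0 - max (m 0) (n 0) = a"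
  by (simp add: local_rule_def)

lemma local_inverse_interlaces:
  assumes "interlaces m p" "interlaces n p"
  shows "interlaces (local_inverse p m n) m" "interlaces (local_inverse p m n) n"
proof -
  have "max (m (Suc r)) (n (Suc r)) \<le> local_inverse p m n r" for r
  proof -
    have "p (Suc r) \<le> min (m r) (n r)" "max (m (Suc r)) (n (Suc r)) \<le> p (Suc r)"
      using assms by (auto simp: interlaces_def)
    moreover have "a \<le> b - (c - a)" if "a \<le> c" "c \<le> b" for a b c :: nat
      using that by simp
    ultimately show ?thesis unfolding local_inverse_def by blast
  qed
  then show "interlaces (local_inverse p m n) m" "interlaces (local_inverse p m n) n"
    by (auto simp: interlaces_def) (simp_all add: local_inverse_def)
qed

lemma local_rule_local_inverse:
  assumes "interlaces m p" "interlaces n p"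
  shows "local_rule (local_inverse p m n) m n (p 0 - max (m 0) (n 0)) = p"
proof
  fix r
  have *: "p (Suc r) \<le> min (m r) (n r)" "max (m r) (n r) \<le> p r" for r
    using assms by (auto simp: interlaces_def)
  show "local_rule (local_inverse p m n) m n (p 0 - max (m 0) (n 0)) r = p r"
  proof (cases r)
    case 0
    then show ?thesis using *(2)[of 0] unfolding local_rule_def by simp
  next
    case (Suc r')
    have "a + (b - (b - (c - a))) = c" if "a \<le> c" "c \<le> b" for a b c :: nat
      using that by simp
    then show ?thesis
      using *(1)[of r'] *(2)[of "Suc r'"] unfolding Suc local_rule_def local_inverse_def nat.case by blast
  qed
qed

lemma growth_interlaces:
  "interlaces (growth A i j) (growth A i (Suc j))" "interlaces (growth A i j) (growth A (Suc i) j)"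
proof -
  \<comment> \<open>Horizontal interlacing is a hypothesis here: in the induction below it is known
    for \<open>i\<close> only, gives the vertical relation to \<open>Suc i\<close>, and with it the
    horizontal one there.\<close>
  have V: "interlaces (growth A i j) (growth A (Suc i) j)" if "\<And>j. interlaces (growth A i j) (growth A i (Suc j))" for i j
  proof (induction j)
    case (Suc j)
    then show ?case using local_rule_interlaces(1)[OF that[of j]] growth_Suc_Suc by simp
  qed (simp add: interlaces_zero)
  have H: "interlaces (growth A i j) (growth A i (Suc j))" for i j
  proof (induction i arbitrary: j)
    case (Suc i)
    then show ?case using local_rule_interlaces(2)[OF Suc[of j] V[of i j]] growth_Suc_Suc by simp
  qed (simp add: interlaces_zero)
  show "interlaces (growth A i j) (growth A i (Suc j))" "interlaces (growth A i j) (growth A (Suc i) j)"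
    using H V by blast+
qed

text \<open>The outer edges determine every inner shape by \<open>local_inverse\<close>, moving
  towards the origin. Each entry is then read from the first row lengths around its square.\<close>

lemma growth_inject:
  assumes P: "\<forall>j\<le>k. growth A k j = growth B k j" and Q: "\<forall>i\<le>k. growth A i k = growth B i k"
    and ij: "i \<in> {1..k}" "j \<in> {1..k}"
  shows "A i j = B i j"
proof -
  have eq: "growth A i j = growth B i j" if "i \<le> k" "j \<le> k" for i j
    using that
  proof (induction i arbitrary: j rule: inc_induct)
    case base
    then show ?case using P by simp
  next
    case (step i)
    note IHi = step.IH
    show ?case using step.prems
    proof (induction j rule: inc_induct)
      case base
      then show ?case using Q step.hyps by simp
    next
      case (step j)
      have "growth C i j = local_inverse (growth C (Suc i) (Suc j)) (growth C i (Suc j)) (growth C (Suc i) j)" for C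
        using local_inverse_local_rule growth_interlaces growth_Suc_Suc by simp
      then show ?case using step IHi by simp
    qed
  qed
  obtain i' j' where "i = Suc i'" "j = Suc j'" using ij by (cases i; cases j) auto
  moreover have "C (Suc i') (Suc j') = growth C (Suc i') (Suc j') 0 - max (growth C i' (Suc j') 0) (growth C (Suc i') j' 0)" for C
    by (simp only: growth_Suc_Suc local_rule_0)
  ultimately show ?thesis using eq ij by (metis Suc_leD atLeastAtMost_iff)
qed

text \<open>Fills the square inwards from its outer edges \<open>i = k\<close> and
  \<open>j = k\<close>. The test \<open>k \<le> i\<close> comes first, so the corner takes the value
  \<open>P k\<close>; agreement with \<open>Q\<close> there is the hypothesis
  \<open>P k = Q k\<close> of \<open>growth_surj\<close>.\<close>

function ungrow :: "(nat \<Rightarrow> nat \<Rightarrow> nat) \<Rightarrow> (nat \<Rightarrow> nat \<Rightarrow> nat) \<Rightarrow> nat \<Rightarrow> nat \<Rightarrow> nat \<Rightarrow> nat \<Rightarrow> nat" where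
  "ungrow P Q k i j =
     (if k \<le> i then P j else if k \<le> j then Q i
      else local_inverse (ungrow P Q k (Suc i) (Suc j)) (ungrow P Q k i (Suc j)) (ungrow P Q k (Suc i) j))"
  by pat_completeness auto
termination by (relation "Wellfounded.measure (\<lambda>(P, Q, k, i, j). (k - i) + (k - j))") auto

declare ungrow.simps [simp del]

text \<open>Interlacing travels inwards with \<open>local_inverse\<close>, so the forward rule,
  started on the edges through the origin, rebuilds the same grid.\<close>

lemma growth_surj:
  assumes PQ: "P k = Q k" "P 0 = (\<lambda>_. 0)" "Q 0 = (\<lambda>_. 0)"
    and intP: "\<And>j. j < k \<Longrightarrow> interlaces (P j) (P (Suc j))"
    and intQ: "\<And>j. j < k \<Longrightarrow> interlaces (Q j) (Q (Suc j))"
  shows "\<exists>A. (\<forall>j\<le>k. growth A k j = P j) \<and> (\<forall>i\<le>k. growth A i k = Q i)"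
proof -
  define G where "G = ungrow P Q k"
  have Gk: "G k j = P j" for j unfolding G_def by (simp add: ungrow.simps)
  have kG: "G i k = Q i" if "i \<le> k" for i
    using that PQ(1) unfolding G_def by (cases "i = k") (simp_all add: ungrow.simps)
  have G: "G i j = local_inverse (G (Suc i) (Suc j)) (G i (Suc j)) (G (Suc i) j)" if "i < k" "j < k" for i j
    using that unfolding G_def by (subst ungrow.simps) simp
  have V: "interlaces (G i j) (G (Suc i) j)"
    if "i < k" "j \<le> k" "\<And>j. j < k \<Longrightarrow> interlaces (G (Suc i) j) (G (Suc i) (Suc j))" for i j
    using that(2)
  proof (induction j rule: inc_induct)
    case base
    then show ?case using intQ that(1) by (simp add: kG)
  next
    case (step j)
    then show ?case
      using local_inverse_interlaces(2)[of "G i (Suc j)" "G (Suc i) (Suc j)" "G (Suc i) j"] that G by simp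
  qed
  have H: "interlaces (G i j) (G i (Suc j))" if "i \<le> k" "j < k" for i j
    using that
  proof (induction i arbitrary: j rule: inc_induct)
    case base
    then show ?case using intP Gk by simp
  next
    case (step i)
    then show ?case
      using local_inverse_interlaces(1)[of "G i (Suc j)" "G (Suc i) (Suc j)" "G (Suc i) j"] V[of i "Suc j"] G by simp
  qed
  have V': "interlaces (G i j) (G (Suc i) j)" if "i < k" "j \<le> k" for i j
    using V[OF that] H that by simp
  \<comment> \<open>Inside the empty shape there is only the empty shape, so the zero corners
    \<open>P 0\<close> and \<open>Q 0\<close> force the edges through the origin to vanish.\<close>
  have zero: "p = (\<lambda>_. 0)" if "interlaces p (\<lambda>_. 0)" for p
    using that by (auto simp: interlaces_def)
  have G0: "G 0 j = (\<lambda>_. 0)" if "j \<le> k" for j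
    using that
  proof (induction j rule: inc_induct)
    case base
    then show ?case using PQ(3) by (simp add: kG)
  next
    case (step j)
    then show ?case using H[of 0 j] zero by simp
  qed
  have G0': "G i 0 = (\<lambda>_. 0)" if "i \<le> k" for i
    using that
  proof (induction i rule: inc_induct)
    case base
    then show ?case using PQ(2) by (simp add: Gk)
  next
    case (step j)
    then show ?case using V'[of j 0] zero by simp
  qed
  \<comment> \<open>The entry that \<open>local_rule_local_inverse\<close> asks for; only positive
    indices are read, so \<open>i - 1\<close> and \<open>j - 1\<close> are genuine
    predecessors.\<close>
  define A where "A i j = G i j 0 - max (G (i - 1) j 0) (G i (j - 1) 0)" for i j
  have "growth A i j = G i j" if "i \<le> k" "j \<le> k" for i j
    using that
  proof (induction i arbitrary: j)
    case 0
    then show ?case using G0 by simp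
  next
    case (Suc i)
    note IHi = Suc.IH and i = Suc.prems(1)
    show ?case using Suc.prems(2)
    proof (induction j)
      case 0
      then show ?case using G0' i by simp
    next
      case (Suc j)
      have "growth A (Suc i) (Suc j) = local_rule (G i j) (G i (Suc j)) (G (Suc i) j)
              (G (Suc i) (Suc j) 0 - max (G i (Suc j) 0) (G (Suc i) j 0))"
        unfolding growth_Suc_Suc using Suc.IH Suc.prems IHi[of j] IHi[of "Suc j"] i
        by (simp add: A_def[of "Suc i" "Suc j"])
      also have "\<dots> = G (Suc i) (Suc j)"
        using G[of i j] local_rule_local_inverse H V' i Suc.prems by simp
      finally show ?case .
    qed
  qed
  then show ?thesis using Gk kG by (intro exI[of _ A]) simp
qed

section \<open>The size of the shape\<close>

lemma growth_vanish: "i \<le> r \<Longrightarrow> growth A i j r = 0"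
proof (induction i arbitrary: r)
  case (Suc i)
  then obtain r' where "r = Suc r'" by (cases r) auto
  \<comment> \<open>A horizontal strip creates at most one new row.\<close>
  then have "growth A (Suc i) j r \<le> growth A i j r'"
    using growth_interlaces(2)[of A i j] by (simp add: interlaces_def)
  then show ?case using Suc \<open>r = Suc r'\<close> by simp
qed simp

text \<open>The rule takes a maximum in row \<open>Suc r\<close> and a minimum in row
  \<open>r\<close>. Maximum plus minimum is the sum, and the shift of index leaves one unpaired
  maximum in row \<open>N\<close>.\<close>

lemma local_rule_sum:
  assumes "interlaces l m" "interlaces l n"
  shows "(\<Sum>r<Suc N. local_rule l m n a r) + (\<Sum>r<N. l r) =
     a + (\<Sum>r<N. m r + n r) + max (m N) (n N)"
proof (induction N)
  case (Suc N)
  have "l N \<le> min (m N) (n N)" using assms by (auto simp: interlaces_def)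
  then have "local_rule l m n a (Suc N) + l N + max (m N) (n N) = m N + n N + max (m (Suc N)) (n (Suc N))"
    by (simp add: local_rule_def) linarith
  then show ?case using Suc by simp
qed (simp add: local_rule_def)

lemma growth_sum:
  assumes "i \<le> N"
  shows "(\<Sum>r<N. growth A i j r) = (\<Sum>x=1..i. \<Sum>y=1..j. A x y)"
  using assms
proof (induction i arbitrary: j)
  case (Suc i)
  note IHi = Suc.IH and i = Suc.prems
  show ?case
  proof (induction j)
    case (Suc j)
    obtain N' where N: "N = Suc N'" using i by (cases N) auto
    \<comment> \<open>In the notation of \<open>local_rule\<close>, \<open>l\<close> and
      \<open>m\<close> vanish in row \<open>N'\<close>. There \<open>n\<close> may be positive, so
      the unpaired maximum is \<open>n N'\<close>, the missing last term of its sum.\<close>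
    have v: "growth A i' j' N' = 0" if "i' \<le> N'" for i' j' using that growth_vanish by blast
    have "(\<Sum>r<N. growth A (Suc i) (Suc j) r) + (\<Sum>r<N. growth A i j r) =
       A (Suc i) (Suc j) + (\<Sum>r<N. growth A i (Suc j) r) + (\<Sum>r<N. growth A (Suc i) j r)"
      using local_rule_sum[OF growth_interlaces, of A i j "A (Suc i) (Suc j)" N'] v[of i] i N
      by (simp add: growth_Suc_Suc sum.distrib)
    then show ?case using Suc.IH IHi i by simp
  qed simp
qed simp

lemma card_diagram:
  assumes "\<And>r. N \<le> r \<Longrightarrow> p r = 0"
  shows "card (diagram p) = (\<Sum>r<N. p r)"
proof -
  have "i \<le> N" if "1 \<le> i" "1 \<le> j" "j \<le> p (i - 1)" for i j
    using assms[of "i - 1"] that by (cases "i \<le> N") auto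
  then have "diagram p = (SIGMA i:{1..N}. {1..p (i - 1)})"
    unfolding diagram_def by auto
  then have "card (diagram p) = (\<Sum>i=1..N. p (i - 1))" by simp
  also have "\<dots> = (\<Sum>r<N. p r)"
    by (rule sum.reindex_bij_witness[of _ Suc "\<lambda>i. i - 1"]) auto
  finally show ?thesis .
qed

lemma diagram_inject: "diagram p = diagram q \<longleftrightarrow> p = q"
proof
  assume eq: "diagram p = diagram q"
  have "c \<le> p r \<longleftrightarrow> c \<le> q r" for c r
    using eq[unfolded set_eq_iff, rule_format, of "(Suc r, c)"] by (cases "c = 0") (auto simp: diagram_def)
  then show "p = q" by (meson ext order_antisym order_refl)
qed simp

section \<open>Chains of interlacing partitions and semistandard tableaux\<close>

definition ssyt :: "nat \<Rightarrow> box set \<Rightarrow> (box \<Rightarrow> nat) set" where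
  "ssyt k D = {T \<in> D \<rightarrow>\<^sub>E {1..k}. semistandard D T}"

lemma skew_dim_eq_card_ssyt: "skew_dim p lam mu = card (ssyt p (lam - mu))"
  by (simp add: skew_dim_def ssyt_def)

lemma finite_ssyt: "finite D \<Longrightarrow> finite (ssyt k D)"
  unfolding ssyt_def by (intro finite_Collect_conjI disjI1) (simp add: finite_PiE)

lemma young_diagram_down_closed:
  assumes "young_diagram D" "(i, j) \<in> D" "1 \<le> i'" "i' \<le> i" "1 \<le> j'" "j' \<le> j"
  shows "(i', j') \<in> D"
proof -
  obtain p where p: "partition_seq p" "D = {(i, j). 1 \<le> i \<and> 1 \<le> j \<and> j \<le> p i}"
    using assms(1) unfolding young_diagram_def by blast
  have "p i \<le> p i'"
    using assms(4)
  proof (induction i rule: dec_induct)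
    case (step n)
    then show ?case using p(1) assms(3) unfolding partition_seq_def by (meson order_trans)
  qed simp
  then show ?thesis using assms p(2) by auto
qed

lemma young_diagram_pos: "young_diagram D \<Longrightarrow> (i, j) \<in> D \<Longrightarrow> 1 \<le> i \<and> 1 \<le> j"
  unfolding young_diagram_def by auto

lemma young_diagram_finite:
  assumes "young_diagram D"
  shows "finite D"
proof -
  obtain p where p: "partition_seq p" "D = {(i, j). 1 \<le> i \<and> 1 \<le> j \<and> j \<le> p i}"
    using assms unfolding young_diagram_def by blast
  have "D = (SIGMA i:{i. 1 \<le> i \<and> p i \<noteq> 0}. {1..p i})" using p(2) by auto
  then show ?thesis using p(1) unfolding partition_seq_def by simp
qed

text \<open>Sublevel sets are left-justified, which orders the rows. For the columns, all boxes
  above a box with entry \<open>Suc l\<close> lie, by interlacing, in the sublevel set of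
  \<open>l\<close>.\<close>

lemma semistandard_chain:
  assumes T: "T \<in> D \<rightarrow> {1..k}"
    and sub: "\<And>j. j \<le> k \<Longrightarrow> {b \<in> D. T b \<le> j} = diagram (P j)"
    and int: "\<And>j. j < k \<Longrightarrow> interlaces (P j) (P (Suc j))"
  shows "semistandard D T"
proof -
  have iff: "T (i, j) \<le> l \<longleftrightarrow> j \<le> P l (i - 1)" if "(i, j) \<in> D" "l \<le> k" for i j l
  proof -
    have "(i, j) \<in> diagram (P k)" using that(1) funcset_mem[OF T that(1)] sub[of k] by auto
    then show ?thesis using that sub[of l] by (auto simp: diagram_def set_eq_iff)
  qed
  have pos: "1 \<le> i" "T (i, j) \<le> k" "1 \<le> T (i, j)" if "(i, j) \<in> D" for i j
  proof -
    have "(i, j) \<in> diagram (P k)" using that funcset_mem[OF T that] sub[of k] by auto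
    then show "1 \<le> i" by (simp add: diagram_def)
    show "T (i, j) \<le> k" "1 \<le> T (i, j)" using funcset_mem[OF T that] by auto
  qed
  have "T (i, j) \<le> T (i, j')" if "(i, j) \<in> D" "(i, j') \<in> D" "j < j'" for i j j'
    using iff[OF that(1), of "T (i, j')"] iff[OF that(2), of "T (i, j')"] pos[OF that(2)] that(3) by simp
  moreover have "T (i, j) < T (i', j)" if le: "(i, j) \<in> D" "(i', j) \<in> D" "i < i'" for i i' j
  proof -
    obtain l where l: "T (i', j) = Suc l" using pos(3)[OF le(2)] by (cases "T (i', j)") auto
    then have "l < k" using pos(2)[OF le(2)] by simp
    note int = int[OF this, unfolded interlaces_def]
    have anti: "P l (Suc r) \<le> P l r" for r using int by (meson order_trans)
    have "j \<le> P (Suc l) (i' - 1)" using iff[OF le(2), of "Suc l"] l \<open>l < k\<close> by simp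
    \<comment> \<open>As \<open>P\<close> counts rows from 0, index \<open>i' - 2\<close> is the row
      just above row \<open>i'\<close>.\<close>
    also have "i' - 1 = Suc (i' - 2)" using le(3) pos(1)[OF le(1)] by simp
    also have "P (Suc l) (Suc (i' - 2)) \<le> P l (i' - 2)" using int by blast
    also have "\<dots> \<le> P l (i - 1)"
      using le(3) by (intro lift_Suc_antimono_le[of "P l", OF anti]) simp
    finally show ?thesis using iff[OF le(1), of l] l \<open>l < k\<close> by simp
  qed
  ultimately show ?thesis unfolding semistandard_def by blast
qed

lemma down_closed_eq_atLeastAtMost:
  fixes S :: "nat set"
  assumes "finite S" "0 \<notin> S" "\<And>c c'. c \<in> S \<Longrightarrow> 1 \<le> c' \<Longrightarrow> c' \<le> c \<Longrightarrow> c' \<in> S"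
  shows "S = {1..card S}"
proof (cases "S = {}")
  case False
  have "S \<subseteq> {1..Max S}" using assms(1,2) by (auto simp: Suc_le_eq intro: gr0I)
  then have "S = {1..Max S}" using assms(3)[OF Max_in[OF assms(1) False]] by auto
  then show ?thesis by (metis card_atLeastAtMost diff_Suc_1)
qed simp

text \<open>\<open>P j r\<close> counts the entries at most \<open>j\<close> in a row. Weakly
  increasing rows make these boxes an initial segment. Strict columns give
  \<open>P (Suc j) (Suc r) \<le> P j r\<close>, as the box above an entry at most
  \<open>Suc j\<close> holds at most \<open>j\<close>.\<close>

lemma ssyt_chain:
  assumes D: "young_diagram D" and T: "T \<in> ssyt k D"
  obtains P where "P 0 = (\<lambda>_. 0)" "\<And>j. j < k \<Longrightarrow> interlaces (P j) (P (Suc j))"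
    "\<And>j. j \<le> k \<Longrightarrow> {b \<in> D. T b \<le> j} = diagram (P j)"
proof -
  define S where "S j r = {c. (Suc r, c) \<in> D \<and> T (Suc r, c) \<le> j}" for j r
  define P where "P j r = card (S j r)" for j r
  have T': "\<And>b. b \<in> D \<Longrightarrow> 1 \<le> T b" "semistandard D T" using T by (auto simp: ssyt_def)
  have fin: "finite (S j r)" for j r
  proof -
    have "S j r \<subseteq> snd ` D" unfolding S_def by force
    then show ?thesis using young_diagram_finite[OF D] finite_subset by blast
  qed
  have S: "S j r = {1..P j r}" for j r
    unfolding P_def
  proof (rule down_closed_eq_atLeastAtMost[OF fin])
    show "0 \<notin> S j r" using young_diagram_pos[OF D] by (auto simp: S_def)
    fix c c' assume c: "c \<in> S j r" "1 \<le> c'" "c' \<le> c"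
    then have "(Suc r, c') \<in> D" using young_diagram_down_closed[OF D, of "Suc r" c] by (simp add: S_def)
    moreover have "T (Suc r, c') \<le> T (Suc r, c)"
      using c calculation T'(2) unfolding semistandard_def S_def by (cases "c' = c") auto
    ultimately show "c' \<in> S j r" using c by (auto simp: S_def)
  qed
  have "P 0 = (\<lambda>_. 0)"
  proof
    fix r
    have "S 0 r = {}" using T'(1) by (force simp: S_def)
    then show "P 0 r = 0" by (simp add: P_def)
  qed
  moreover have "interlaces (P j) (P (Suc j))" if "j < k" for j
    unfolding interlaces_def
  proof (intro allI conjI)
    fix r
    show "P j r \<le> P (Suc j) r" unfolding P_def by (rule card_mono[OF fin]) (auto simp: S_def)
    show "P (Suc j) (Suc r) \<le> P j r"
      unfolding P_def
    proof (rule card_mono[OF fin], rule)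
      fix c assume c: "c \<in> S (Suc j) (Suc r)"
      then have m: "(Suc r, c) \<in> D"
        using young_diagram_down_closed[OF D, of "Suc (Suc r)" c "Suc r" c]
          young_diagram_pos[OF D, of "Suc (Suc r)" c] by (simp add: S_def)
      then have "T (Suc r, c) < T (Suc (Suc r), c)"
        using T'(2) c unfolding semistandard_def S_def by auto
      then show "c \<in> S j r" using c m by (simp add: S_def)
    qed
  qed
  moreover have "{b \<in> D. T b \<le> j} = diagram (P j)" for j
  proof -
    have "(i, c) \<in> {b \<in> D. T b \<le> j} \<longleftrightarrow> (i, c) \<in> diagram (P j)" for i c
    proof (cases i)
      case 0
      then show ?thesis using young_diagram_pos[OF D, of i c] by (auto simp: diagram_def)
    next
      case (Suc r)
      then have "(i, c) \<in> {b \<in> D. T b \<le> j} \<longleftrightarrow> c \<in> S j r" by (simp add: S_def)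
      also have "\<dots> \<longleftrightarrow> (i, c) \<in> diagram (P j)" unfolding S using Suc by (auto simp: diagram_def)
      finally show ?thesis .
    qed
    then show ?thesis by (simp only: set_eq_iff split_paired_All) simp
  qed
  ultimately show ?thesis using that by blast
qed

section \<open>The bijection between matrices and pairs of tableaux\<close>

definition insertion_tableau :: "nat \<Rightarrow> (nat \<times> nat \<Rightarrow> nat) \<Rightarrow> box \<Rightarrow> nat" where
  "insertion_tableau k X = entry (fst (rsk k (curry X)))"

definition recording_tableau :: "nat \<Rightarrow> (nat \<times> nat \<Rightarrow> nat) \<Rightarrow> box \<Rightarrow> nat" where
  "recording_tableau k X = entry (snd (rsk k (curry X)))"

lemma
  assumes "diagram (growth (curry X) k k) = D"
  shows insertion_tableau_sublevel:
      "j \<le> k \<Longrightarrow> {b \<in> D. insertion_tableau k X b \<le> j} = diagram (growth (curry X) k j)"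
    and recording_tableau_sublevel:
      "j \<le> k \<Longrightarrow> {b \<in> D. recording_tableau k X b \<le> j} = diagram (growth (curry X) j k)"
  using insertion_sublevel[of j k "curry X"] recording_sublevel[of j k "curry X"] assms
  unfolding insertion_tableau_def recording_tableau_def shape_rsk by blast+

lemma growth_cong:
  assumes "\<And>x y. 1 \<le> x \<Longrightarrow> x \<le> i \<Longrightarrow> 1 \<le> y \<Longrightarrow> y \<le> j \<Longrightarrow> A x y = B x y"
  shows "growth A i j = growth B i j"
  using assms
proof (induction i arbitrary: j)
  case (Suc i)
  note IHi = Suc.IH
  show ?case using Suc.prems
  proof (induction j)
    case (Suc j)
    have "growth A i j = growth B i j" "growth A i (Suc j) = growth B i (Suc j)"
      using Suc.prems by (auto intro!: IHi)
    moreover have "growth A (Suc i) j = growth B (Suc i) j"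
      using Suc.prems by (intro Suc.IH) auto
    ultimately show ?case using Suc.prems[of "Suc i" "Suc j"] unfolding growth_Suc_Suc by simp
  qed simp
qed simp

lemma chain_ssyt:
  assumes sub: "\<And>j. j \<le> k \<Longrightarrow> {b \<in> D. T b \<le> j} = diagram (P j)"
    and int: "\<And>j. j < k \<Longrightarrow> interlaces (P j) (P (Suc j))"
    and P: "P 0 = (\<lambda>_. 0)" "diagram (P k) = D"
  shows "restrict T D \<in> ssyt k D"
proof -
  have "\<not> T b \<le> 0" if "b \<in> D" for b
  proof
    assume "T b \<le> 0"
    then have "b \<in> diagram (P 0)" using sub[of 0] that by blast
    then show False using P(1) by (auto simp: diagram_def)
  qed
  moreover have "T b \<le> k" if "b \<in> D" for b using sub[of k] P(2) that by auto
  ultimately have "T b \<in> {1..k}" if "b \<in> D" for b using that by (simp add: Suc_le_eq)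
  then have TD: "restrict T D \<in> D \<rightarrow>\<^sub>E {1..k}" by (intro restrict_PiE_iff[THEN iffD2] ballI)
  have "{b \<in> D. restrict T D b \<le> j} = diagram (P j)" if "j \<le> k" for j
    using sub[OF that] by auto
  moreover have "restrict T D \<in> D \<rightarrow> {1..k}" using PiE_mem[OF TD] by (intro funcsetI)
  ultimately have "semistandard D (restrict T D)"
    using semistandard_chain int by blast
  then show ?thesis using TD by (simp add: ssyt_def)
qed

text \<open>A tableau amounts to its chain of sublevel sets, so the claim reduces to
  \<open>growth_inject\<close> and \<open>growth_surj\<close>. Matrices and tableaux are taken as
  extensional functions, since only their values on the square and on \<open>D\<close> are
  determined.\<close>

lemma rsk_bij_betw:
  assumes D: "young_diagram D"
  shows "bij_betw (\<lambda>X. (restrict (insertion_tableau k X) D, restrict (recording_tableau k X) D))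
     {X \<in> {1..k} \<times> {1..k} \<rightarrow>\<^sub>E UNIV. diagram (growth (curry X) k k) = D}
     (ssyt k D \<times> ssyt k D)"
  unfolding bij_betw_def
proof
  let ?\<X> = "{X \<in> {1..k} \<times> {1..k} \<rightarrow>\<^sub>E UNIV. diagram (growth (curry X) k k) = D}"
  let ?f = "\<lambda>X. (restrict (insertion_tableau k X) D, restrict (recording_tableau k X) D)"
  show "inj_on ?f ?\<X>"
  proof (rule inj_onI)
    fix X Y assume X: "X \<in> ?\<X>" and Y: "Y \<in> ?\<X>" and eq: "?f X = ?f Y"
    have ins: "insertion_tableau k X b = insertion_tableau k Y b"
      and rec: "recording_tableau k X b = recording_tableau k Y b" if "b \<in> D" for b
      using eq that by (metis prod.inject restrict_apply')+
    have dX: "diagram (growth (curry X) k k) = D" and dY: "diagram (growth (curry Y) k k) = D"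
      using X Y by auto
    have "growth (curry X) k j = growth (curry Y) k j" if "j \<le> k" for j
    proof -
      have "{b \<in> D. insertion_tableau k X b \<le> j} = {b \<in> D. insertion_tableau k Y b \<le> j}"
        using ins by auto
      then show ?thesis
        unfolding insertion_tableau_sublevel[OF dX that] insertion_tableau_sublevel[OF dY that] diagram_inject .
    qed
    moreover have "growth (curry X) j k = growth (curry Y) j k" if "j \<le> k" for j
    proof -
      have "{b \<in> D. recording_tableau k X b \<le> j} = {b \<in> D. recording_tableau k Y b \<le> j}"
        using rec by auto
      then show ?thesis
        unfolding recording_tableau_sublevel[OF dX that] recording_tableau_sublevel[OF dY that] diagram_inject .
    qed
    ultimately have "curry X i j = curry Y i j" if "i \<in> {1..k}" "j \<in> {1..k}" for i j
      using growth_inject[of k "curry X" "curry Y" i j] that by blast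
    then have "X b = Y b" if "b \<in> {1..k} \<times> {1..k}" for b using that by (cases b) auto
    moreover have "X \<in> {1..k} \<times> {1..k} \<rightarrow>\<^sub>E UNIV" "Y \<in> {1..k} \<times> {1..k} \<rightarrow>\<^sub>E UNIV" using X Y by blast+
    ultimately show "X = Y" using PiE_ext by blast
  qed
  show "?f ` ?\<X> = ssyt k D \<times> ssyt k D"
  proof (intro equalityI subsetI)
    fix TU assume "TU \<in> ?f ` ?\<X>"
    then obtain X where X: "X \<in> ?\<X>" "TU = ?f X" by blast
    then have dX: "diagram (growth (curry X) k k) = D" by blast
    have "restrict (insertion_tableau k X) D \<in> ssyt k D"
      by (rule chain_ssyt[OF insertion_tableau_sublevel[OF dX]]) (simp_all add: growth_interlaces dX)
    moreover have "restrict (recording_tableau k X) D \<in> ssyt k D"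
      by (rule chain_ssyt[OF recording_tableau_sublevel[OF dX]]) (simp_all add: growth_interlaces dX)
    ultimately show "TU \<in> ssyt k D \<times> ssyt k D" using X by simp
  next
    fix TU assume "TU \<in> ssyt k D \<times> ssyt k D"
    then obtain T U where TU: "TU = (T, U)" "T \<in> ssyt k D" "U \<in> ssyt k D" by blast
    obtain P where P: "P 0 = (\<lambda>_. 0)" "\<And>j. j < k \<Longrightarrow> interlaces (P j) (P (Suc j))"
      "\<And>j. j \<le> k \<Longrightarrow> {b \<in> D. T b \<le> j} = diagram (P j)"
      using ssyt_chain[OF D TU(2)] by blast
    obtain Q where Q: "Q 0 = (\<lambda>_. 0)" "\<And>j. j < k \<Longrightarrow> interlaces (Q j) (Q (Suc j))"
      "\<And>j. j \<le> k \<Longrightarrow> {b \<in> D. U b \<le> j} = diagram (Q j)"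
      using ssyt_chain[OF D TU(3)] by blast
    have T: "T \<in> D \<rightarrow>\<^sub>E {1..k}" and U: "U \<in> D \<rightarrow>\<^sub>E {1..k}" using TU by (auto simp: ssyt_def)
    have Dk: "diagram (P k) = D" "diagram (Q k) = D"
      using P(3)[of k] Q(3)[of k] PiE_mem[OF T] PiE_mem[OF U] by auto
    \<comment> \<open>Both chains end in \<open>D\<close>, which is the compatibility needed at the
      corner of the grid.\<close>
    then have "P k = Q k" using diagram_inject by metis
    then obtain A where A: "\<And>j. j \<le> k \<Longrightarrow> growth A k j = P j" "\<And>i. i \<le> k \<Longrightarrow> growth A i k = Q i"
      using growth_surj[OF _ P(1) Q(1) P(2) Q(2)] by blast
    define X where "X = restrict (case_prod A) ({1..k} \<times> {1..k})"
    have XA: "growth (curry X) i j = growth A i j" if "i \<le> k" "j \<le> k" for i j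
      by (rule growth_cong) (use that in \<open>simp_all add: X_def\<close>)
    have dX: "diagram (growth (curry X) k k) = D" using XA[of k k] A(1)[of k] Dk(1) by simp
    then have X: "X \<in> ?\<X>" unfolding X_def by (auto intro: restrict_PiE)
    \<comment> \<open>Values at most \<open>k\<close> are determined by the sublevel sets for
      \<open>j \<le> k\<close>; the case \<open>j = k\<close> also bounds \<open>T1\<close>.\<close>
    have det: "restrict T1 D = T2"
      if T2: "T2 \<in> D \<rightarrow>\<^sub>E {1..k}" and sub: "\<And>j. j \<le> k \<Longrightarrow> {b \<in> D. T1 b \<le> j} = {b \<in> D. T2 b \<le> j}" for T1 T2 :: "box \<Rightarrow> nat"
    proof (rule PiE_ext[of _ D "\<lambda>_. UNIV"])
      fix b assume b: "b \<in> D"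
      then have "T2 b \<le> k" using PiE_mem[OF T2 b] by auto
      moreover have "T1 b \<le> j \<longleftrightarrow> T2 b \<le> j" if "j \<le> k" for j using sub[OF that] b by blast
      ultimately have "T1 b = T2 b" by (meson order_antisym order_refl order_trans)
      then show "restrict T1 D b = T2 b" using b by simp
    qed (use T2 in auto)
    have "restrict (insertion_tableau k X) D = T"
      by (rule det[OF T]) (simp add: insertion_tableau_sublevel[OF dX] P(3) XA A(1))
    moreover have "restrict (recording_tableau k X) D = U"
      by (rule det[OF U]) (simp add: recording_tableau_sublevel[OF dX] Q(3) XA A(2))
    ultimately have "TU = ?f X" using TU(1) by simp
    then show "TU \<in> ?f ` ?\<X>" using X by (rule image_eqI)
  qed
qed

section \<open>Tableaux with prescribed sublevel sets\<close>

lemma semistandard_subset: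
  "semistandard D T \<Longrightarrow> D' \<subseteq> D \<Longrightarrow> (\<And>b. b \<in> D' \<Longrightarrow> U b = T b) \<Longrightarrow> semistandard D' U"
  unfolding semistandard_def by (metis subsetD)

text \<open>Entries on the outer part are stored shifted down by \<open>c\<close>, so that they
  start at 1 as in \<open>skew_dim\<close>.\<close>

definition glue :: "box set \<Rightarrow> box set \<Rightarrow> nat \<Rightarrow> (box \<Rightarrow> nat) \<times> (box \<Rightarrow> nat) \<Rightarrow> box \<Rightarrow> nat" where
  "glue D E c TU = (\<lambda>b\<in>E. if b \<in> D then fst TU b else snd TU b + c)"

lemma ssyt_glue:
  assumes D: "young_diagram D" and E: "young_diagram E" and DE: "D \<subseteq> E" and cd: "c \<le> d"
    and T: "T \<in> ssyt c D" and U: "U \<in> ssyt (d - c) (E - D)"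
  shows "glue D E c (T, U) \<in> ssyt d E"
proof -
  let ?G = "glue D E c (T, U)"
  have T': "T b \<in> {1..c}" if "b \<in> D" for b using T PiE_mem[of T D "\<lambda>_. {1..c}"] that by (simp add: ssyt_def)
  have U': "U b \<in> {1..d - c}" if "b \<in> E - D" for b
    using U PiE_mem[of U "E - D" "\<lambda>_. {1..d - c}"] that by (simp add: ssyt_def)
  have G: "?G b = T b" if "b \<in> D" for b using that DE by (auto simp: glue_def)
  have G': "?G b = U b + c" if "b \<in> E" "b \<notin> D" for b using that by (auto simp: glue_def)
  have "?G b \<in> {1..d}" if "b \<in> E" for b
    using T'[of b] U'[of b] G[of b] G'[of b] that cd by (cases "b \<in> D") auto
  then have "?G \<in> E \<rightarrow>\<^sub>E {1..d}" by (auto simp: glue_def)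
  moreover have "semistandard E ?G"
    unfolding semistandard_def
  proof (intro conjI allI impI; elim conjE)
    fix i j j' assume *: "(i, j) \<in> E" "(i, j') \<in> E" "j < j'"
    \<comment> \<open>\<open>D\<close> is closed to the left and upwards, so a mixed pair has its
      first box in \<open>D\<close>, where entries are at most \<open>c\<close>.\<close>
    consider "(i, j') \<in> D" "(i, j) \<in> D" | "(i, j') \<notin> D" "(i, j) \<in> D" | "(i, j') \<notin> D" "(i, j) \<notin> D"
      using young_diagram_down_closed[OF D, of i j' i j] young_diagram_pos[OF E *(1)] *(3) by auto
    then show "?G (i, j) \<le> ?G (i, j')"
    proof cases
      case 1
      then have "T (i, j) \<le> T (i, j')" using T *(3) unfolding ssyt_def semistandard_def by blast
      then show ?thesis using G 1 by simp
    next
      case 2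
      then show ?thesis using G[OF 2(2)] G'[OF *(2) 2(1)] T'[OF 2(2)] by simp
    next
      case 3
      then have "U (i, j) \<le> U (i, j')" using U * unfolding ssyt_def semistandard_def by blast
      then show ?thesis using G' 3 * by simp
    qed
  next
    fix i i' j assume *: "(i, j) \<in> E" "(i', j) \<in> E" "i < i'"
    consider "(i', j) \<in> D" "(i, j) \<in> D" | "(i', j) \<notin> D" "(i, j) \<in> D" | "(i', j) \<notin> D" "(i, j) \<notin> D"
      using young_diagram_down_closed[OF D, of i' j i j] young_diagram_pos[OF E *(1)] *(3) by auto
    then show "?G (i, j) < ?G (i', j)"
    proof cases
      case 1
      then have "T (i, j) < T (i', j)" using T *(3) unfolding ssyt_def semistandard_def by blast
      then show ?thesis using G 1 by simp
    next
      case 2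
      then show ?thesis using G[OF 2(2)] G'[OF *(2) 2(1)] T'[OF 2(2)] U'[of "(i', j)"] * by simp
    next
      case 3
      then have "U (i, j) < U (i', j)" using U * unfolding ssyt_def semistandard_def by blast
      then show ?thesis using G' 3 * by simp
    qed
  qed
  ultimately show ?thesis by (simp add: ssyt_def)
qed

text \<open>Outside \<open>D\<close> all entries exceed \<open>c\<close>, so the subtraction is
  exact and keeps strict inequalities.\<close>

lemma ssyt_split:
  assumes T: "T \<in> ssyt d E" and sub: "{b \<in> E. T b \<le> c} = D"
  shows "restrict T D \<in> ssyt c D" "restrict (\<lambda>b. T b - c) (E - D) \<in> ssyt (d - c) (E - D)"
proof -
  have ss: "semistandard E T" and T': "\<And>b. b \<in> E \<Longrightarrow> T b \<in> {1..d}"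
    using T PiE_mem[of T E "\<lambda>_. {1..d}"] by (simp_all add: ssyt_def)
  have D: "b \<in> D \<Longrightarrow> b \<in> E \<and> T b \<le> c" for b using sub by blast
  have D': "b \<in> E - D \<Longrightarrow> c < T b" for b using sub by auto
  have "semistandard D (restrict T D)"
    using D by (intro semistandard_subset[OF ss]) auto
  moreover have "restrict T D b \<in> {1..c}" if "b \<in> D" for b using D[OF that] T'[of b] that by simp
  ultimately show "restrict T D \<in> ssyt c D" by (auto simp: ssyt_def)
  have ss': "semistandard (E - D) T" by (rule semistandard_subset[OF ss]) auto
  let ?U = "restrict (\<lambda>b. T b - c) (E - D)"
  have "semistandard (E - D) ?U"
    unfolding semistandard_def
  proof (intro conjI allI impI; elim conjE)
    fix i j j' assume *: "(i, j) \<in> E - D" "(i, j') \<in> E - D" "j < j'"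
    then have "T (i, j) \<le> T (i, j')" using ss' unfolding semistandard_def by blast
    then show "?U (i, j) \<le> ?U (i, j')" using *(1,2) by simp
  next
    fix i i' j assume *: "(i, j) \<in> E - D" "(i', j) \<in> E - D" "i < i'"
    then have "T (i, j) < T (i', j)" using ss' unfolding semistandard_def by blast
    then show "?U (i, j) < ?U (i', j)" using *(1,2) D'[OF *(1)] by simp
  qed
  moreover have "?U b \<in> {1..d - c}" if "b \<in> E - D" for b using D'[OF that] T'[of b] that by auto
  ultimately show "?U \<in> ssyt (d - c) (E - D)" by (auto simp: ssyt_def)
qed

definition ssyt_through :: "nat \<Rightarrow> (nat \<Rightarrow> nat) \<Rightarrow> (nat \<Rightarrow> box set) \<Rightarrow> (box \<Rightarrow> nat) set" where
  "ssyt_through n c D = {T \<in> ssyt (c n) (D n). \<forall>i<n. {b \<in> D n. T b \<le> c i} = D i}"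

text \<open>Cutting off the outermost layer is a bijection onto pairs, with inverse
  \<open>glue\<close>, and contributes the last factor. The induction starts from the single tableau
  of empty shape.\<close>

lemma card_ssyt_through:
  assumes "\<And>i. i \<le> n \<Longrightarrow> young_diagram (D i)" "\<And>i. i < n \<Longrightarrow> D i \<subseteq> D (Suc i)"
    "\<And>i. i < n \<Longrightarrow> c i \<le> c (Suc i)" "D 0 = {}"
  shows "card (ssyt_through n c D) = (\<Prod>i<n. card (ssyt (c (Suc i) - c i) (D (Suc i) - D i)))"
  using assms
proof (induction n)
  case 0
  have "ssyt_through 0 c D = {\<lambda>_. undefined}"
    using 0(4) by (auto simp: ssyt_through_def ssyt_def semistandard_def)
  then show ?case by simp
next
  case (Suc n)
  let ?D = "D n" and ?E = "D (Suc n)" and ?c = "c n" and ?d = "c (Suc n)"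
  have DE: "?D \<subseteq> ?E" "?c \<le> ?d" using Suc.prems by auto
  have mono: "D i \<subseteq> ?D \<and> c i \<le> ?c" if "i \<le> n" for i
    using that
  proof (induction i rule: inc_induct)
    case (step i)
    then show ?case using Suc.prems(2,3)[of i] by auto
  qed simp
  let ?f = "\<lambda>T. (restrict T ?D, restrict (\<lambda>b. T b - ?c) (?E - ?D))"
  have "bij_betw ?f (ssyt_through (Suc n) c D) (ssyt_through n c D \<times> ssyt (?d - ?c) (?E - ?D))"
  proof (rule bij_betwI)
    show "?f \<in> ssyt_through (Suc n) c D \<rightarrow> ssyt_through n c D \<times> ssyt (?d - ?c) (?E - ?D)"
    proof
      fix T assume T: "T \<in> ssyt_through (Suc n) c D"
      then have T': "T \<in> ssyt ?d ?E" "\<And>i. i \<le> n \<Longrightarrow> {b \<in> ?E. T b \<le> c i} = D i"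
        by (auto simp: ssyt_through_def)
      have "{b \<in> ?D. restrict T ?D b \<le> c i} = D i" if "i < n" for i
      proof -
        have "{b \<in> ?D. restrict T ?D b \<le> c i} = ?D \<inter> {b \<in> ?E. T b \<le> c i}" using DE by auto
        then show ?thesis using T'(2)[of i] mono[of i] that by auto
      qed
      then show "?f T \<in> ssyt_through n c D \<times> ssyt (?d - ?c) (?E - ?D)"
        using ssyt_split[OF T'(1) T'(2)[OF order_refl]] by (simp add: ssyt_through_def)
    qed
    show "glue ?D ?E ?c \<in> ssyt_through n c D \<times> ssyt (?d - ?c) (?E - ?D) \<rightarrow> ssyt_through (Suc n) c D"
    proof
      fix TU assume "TU \<in> ssyt_through n c D \<times> ssyt (?d - ?c) (?E - ?D)"
      then obtain T U where TU: "TU = (T, U)" "T \<in> ssyt_through n c D" "U \<in> ssyt (?d - ?c) (?E - ?D)" by blast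
      have T: "T \<in> ssyt ?c ?D" "\<And>i. i < n \<Longrightarrow> {b \<in> ?D. T b \<le> c i} = D i"
        using TU(2) by (auto simp: ssyt_through_def)
      have Tc: "T b \<le> ?c" if "b \<in> ?D" for b
        using T(1) PiE_mem[of T ?D "\<lambda>_. {1..?c}"] that by (simp add: ssyt_def)
      have U: "1 \<le> U b" if "b \<in> ?E - ?D" for b
        using TU(3) PiE_mem[of U "?E - ?D" "\<lambda>_. {1..?d - ?c}"] that by (simp add: ssyt_def)
      have "{b \<in> ?E. glue ?D ?E ?c TU b \<le> c i} = D i" if "i < Suc n" for i
      proof -
        \<comment> \<open>Entries of the outer layer are above \<open>c n\<close>, so all these
          sublevel sets see only the inner tableau.\<close>
        have "\<not> glue ?D ?E ?c TU b \<le> c i" if "b \<in> ?E - ?D" for b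
          using U[OF that] mono[of i] \<open>i < Suc n\<close> that by (auto simp: glue_def TU(1))
        then have "{b \<in> ?E. glue ?D ?E ?c TU b \<le> c i} = {b \<in> ?D. T b \<le> c i}"
          using DE by (auto simp: glue_def TU(1))
        also have "\<dots> = D i" using T(2)[of i] Tc that by (cases "i = n") auto
        finally show ?thesis .
      qed
      moreover have "glue ?D ?E ?c TU \<in> ssyt ?d ?E"
        unfolding TU(1) using Suc.prems by (intro ssyt_glue T TU) auto
      ultimately show "glue ?D ?E ?c TU \<in> ssyt_through (Suc n) c D" by (simp add: ssyt_through_def)
    qed
    show "glue ?D ?E ?c (?f T) = T" if "T \<in> ssyt_through (Suc n) c D" for T
    proof (rule PiE_ext)
      have T: "T \<in> ssyt ?d ?E" "{b \<in> ?E. T b \<le> ?c} = ?D" using that by (auto simp: ssyt_through_def)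
      show "T \<in> ?E \<rightarrow>\<^sub>E UNIV" using T(1) by (auto simp: ssyt_def)
      show "glue ?D ?E ?c (?f T) \<in> ?E \<rightarrow>\<^sub>E UNIV" by (simp add: glue_def)
      fix b assume b: "b \<in> ?E"
      then have "b \<notin> ?D \<Longrightarrow> ?c < T b" unfolding T(2)[symmetric] by simp
      then show "glue ?D ?E ?c (?f T) b = T b"
        using b by (cases "b \<in> ?D") (simp_all add: glue_def)
    qed
    show "?f (glue ?D ?E ?c TU) = TU" if "TU \<in> ssyt_through n c D \<times> ssyt (?d - ?c) (?E - ?D)" for TU
    proof -
      obtain T U where eq: "TU = (T, U)" by (cases TU)
      then have TU: "TU = (T, U)" "T \<in> ?D \<rightarrow>\<^sub>E {1..?c}" "U \<in> ?E - ?D \<rightarrow>\<^sub>E {1..?d - ?c}"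
        using that by (simp_all add: ssyt_through_def ssyt_def)
      have ext: "T \<in> extensional ?D" "U \<in> extensional (?E - ?D)"
        using TU(2,3) by (simp_all only: PiE_iff)
      have "restrict (glue ?D ?E ?c TU) ?D = T"
        by (rule extensionalityI[of _ ?D]) (use TU(1) ext(1) DE in \<open>auto simp: glue_def\<close>)
      moreover have "restrict (\<lambda>b. glue ?D ?E ?c TU b - ?c) (?E - ?D) = U"
        by (rule extensionalityI[of _ "?E - ?D"]) (use TU(1) ext(2) in \<open>auto simp: glue_def\<close>)
      ultimately show ?thesis using TU(1) by simp
    qed
  qed
  then have "card (ssyt_through (Suc n) c D) = card (ssyt_through n c D) * card (ssyt (?d - ?c) (?E - ?D))"
    by (simp only: bij_betw_same_card card_cartesian_product)
  moreover have "card (ssyt_through n c D) = (\<Prod>i<n. card (ssyt (c (Suc i) - c i) (D (Suc i) - D i)))"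
  proof (rule Suc.IH)
    show "D 0 = {}" by fact
    show "young_diagram (D i)" if "i \<le> n" for i using Suc.prems(1)[of i] that by simp
    fix i assume "i < n"
    then show "D i \<subseteq> D (Suc i)" "c i \<le> c (Suc i)" using Suc.prems(2,3)[of i] by simp_all
  qed
  ultimately show ?case by simp
qed

section \<open>Grid points and probabilities\<close>

text \<open>For \<open>x \<ge> 0\<close> this is the number of positive multiples of the mesh up to
  \<open>x\<close>; a condition on real time becomes a bound on entries.\<close>

definition grid_index :: "real \<Rightarrow> nat \<Rightarrow> real \<Rightarrow> nat" where
  "grid_index \<theta> k x = nat \<lfloor>x / (\<theta> / real k)\<rfloor>"

lemma grid_index_iff:
  assumes "\<theta> > 0" "k \<ge> 1" "x \<ge> 0"
  shows "real e * (\<theta> / real k) \<le> x \<longleftrightarrow> e \<le> grid_index \<theta> k x"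
proof -
  have h: "\<theta> / real k > 0" using assms by simp
  have "real e * (\<theta> / real k) \<le> x \<longleftrightarrow> real e \<le> x / (\<theta> / real k)"
    using pos_le_divide_eq[OF h] by simp
  also have "\<dots> \<longleftrightarrow> int e \<le> \<lfloor>x / (\<theta> / real k)\<rfloor>" by (simp add: le_floor_iff)
  also have "\<dots> \<longleftrightarrow> e \<le> grid_index \<theta> k x"
    using assms by (simp add: grid_index_def le_nat_iff)
  finally show ?thesis .
qed

lemma grid_index_mono:
  assumes "\<theta> > 0" "x \<le> y"
  shows "grid_index \<theta> k x \<le> grid_index \<theta> k y"
  unfolding grid_index_def using assms by (intro nat_mono floor_mono divide_right_mono) auto

lemma grid_index_0 [simp]: "grid_index \<theta> k 0 = 0"
  by (simp add: grid_index_def)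

lemma grid_index_end: "\<theta> > 0 \<Longrightarrow> grid_index \<theta> k \<theta> = k"
  by (simp add: grid_index_def)

lemma lattice_count_eq:
  assumes "\<theta> > 0" "k \<ge> 1" "0 \<le> x" "x \<le> y" "y \<le> \<theta>"
  shows "lattice_count \<theta> k x y = grid_index \<theta> k y - grid_index \<theta> k x"
proof -
  let ?h = "\<theta> / real k"
  have k: "grid_index \<theta> k y \<le> k"
    using grid_index_mono[OF assms(1,5), of k] grid_index_end[OF assms(1)] by simp
  have iff: "real a * ?h \<in> {x<..y} \<longleftrightarrow> a \<in> {grid_index \<theta> k x<..grid_index \<theta> k y}" for a
    using grid_index_iff[OF assms(1,2), of x a] grid_index_iff[OF assms(1,2), of y a] assms(3,4)
    by (simp del: times_divide_eq_right add: not_le[symmetric])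
  have "discretization \<theta> k \<inter> {x<..y} = (\<lambda>a. real a * ?h) ` {grid_index \<theta> k x<..grid_index \<theta> k y}"
    (is "_ = ?g ` ?I")
  proof -
    have "discretization \<theta> k \<inter> {x<..y} = ?g ` {a \<in> {1..k}. ?g a \<in> {x<..y}}"
      unfolding discretization_def by blast
    also have "{a \<in> {1..k}. ?g a \<in> {x<..y}} = ?I" unfolding iff using k by auto
    finally show ?thesis .
  qed
  moreover have "inj_on (\<lambda>a. real a * ?h) {grid_index \<theta> k x<..grid_index \<theta> k y}"
    using assms(1,2) by (auto simp: inj_on_def)
  ultimately show ?thesis unfolding lattice_count_def by (simp add: card_image del: times_divide_eq_right)
qed

lemma rsk_cong:
  assumes "\<And>i j. i \<in> {1..k} \<Longrightarrow> j \<in> {1..k} \<Longrightarrow> A i j = B i j"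
  shows "rsk k A = rsk k B"
proof -
  have "generalized_permutation k A = generalized_permutation k B"
    unfolding generalized_permutation_def
    by (intro arg_cong[of _ _ concat] map_cong refl) (use assms in auto)
  then show ?thesis by (simp add: rsk_def)
qed

lemma pair_process_rsk:
  assumes "\<theta> > 0" "k \<ge> 1"
  shows "-\<theta> \<le> t \<Longrightarrow> t \<le> 0 \<Longrightarrow> pair_process \<theta> k (rsk k (curry X)) t =
      {b \<in> diagram (growth (curry X) k k). insertion_tableau k X b \<le> grid_index \<theta> k (\<theta> + t)}"
    and "0 \<le> t \<Longrightarrow> t \<le> \<theta> \<Longrightarrow> pair_process \<theta> k (rsk k (curry X)) t =
      {b \<in> diagram (growth (curry X) k k). recording_tableau k X b \<le> grid_index \<theta> k (\<theta> - t)}"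
proof -
  have L: "pair_process \<theta> k (rsk k (curry X)) t =
      {b \<in> diagram (growth (curry X) k k). insertion_tableau k X b \<le> grid_index \<theta> k (\<theta> + t)}"
    if "-\<theta> \<le> t" "t \<le> 0" for t
    using that grid_index_iff[OF assms, of "\<theta> + t"]
    by (simp add: pair_process_def tableau_process_def shape_rsk insertion_tableau_def del: times_divide_eq_right)
  show "-\<theta> \<le> t \<Longrightarrow> t \<le> 0 \<Longrightarrow> pair_process \<theta> k (rsk k (curry X)) t =
      {b \<in> diagram (growth (curry X) k k). insertion_tableau k X b \<le> grid_index \<theta> k (\<theta> + t)}"
    by (rule L)
  assume t: "0 \<le> t" "t \<le> \<theta>"
  show "pair_process \<theta> k (rsk k (curry X)) t =
      {b \<in> diagram (growth (curry X) k k). recording_tableau k X b \<le> grid_index \<theta> k (\<theta> - t)}"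
  \<comment> \<open>At time 0 the process is defined through the insertion tableau. The clock then
    shows \<open>\<theta>\<close>, where the sublevel sets of both tableaux are the whole
    shape.\<close>
  proof (cases "t = 0")
    case True
    then show ?thesis
      using L[of 0] assms insertion_tableau_sublevel[OF refl order_refl, of X k]
        recording_tableau_sublevel[OF refl order_refl, of X k] by (simp add: grid_index_end)
  next
    case False
    then show ?thesis
      using t grid_index_iff[OF assms, of "\<theta> - t"]
      by (simp add: pair_process_def tableau_process_def shape_rsk recording_tableau_def del: times_divide_eq_right)
  qed
qed

section \<open>The probability of one matrix\<close>

lemma (in prob_space) iid_geometric_prob:
  assumes iid: "iid_geometric \<theta> k \<xi>" and k: "k \<ge> 1" and x: "x \<in> {1..k} \<times> {1..k} \<rightarrow>\<^sub>E UNIV"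
  defines "E \<equiv> {\<omega> \<in> space M. restrict (\<lambda>(i, j). \<xi> i j \<omega>) ({1..k} \<times> {1..k}) = x}"
  shows "E \<in> events"
    and "prob E = (1 - \<theta>\<^sup>2 / (real k)\<^sup>2) ^ (k\<^sup>2) * (\<theta>\<^sup>2 / (real k)\<^sup>2) ^ (\<Sum>b\<in>{1..k} \<times> {1..k}. x b)"
proof -
  let ?I = "{1..k} \<times> {1..k}"
  let ?A = "\<lambda>b. (case b of (i, j) \<Rightarrow> \<xi> i j) -` {x b} \<inter> space M"
  have ind: "indep_vars (\<lambda>_. count_space UNIV) (\<lambda>(i, j). \<xi> i j) ?I"
    and geo: "\<And>i j y. i \<in> {1..k} \<Longrightarrow> j \<in> {1..k} \<Longrightarrow>
      prob {\<omega> \<in> space M. \<xi> i j \<omega> = y} = (1 - \<theta>\<^sup>2 / (real k)\<^sup>2) * (\<theta>\<^sup>2 / (real k)\<^sup>2) ^ y"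
    using iid unfolding iid_geometric_def by blast+
  have ne: "?I \<noteq> {}" using k by auto
  have "restrict (\<lambda>(i, j). \<xi> i j \<omega>) ?I = x \<longleftrightarrow> (\<forall>b\<in>?I. (case b of (i, j) \<Rightarrow> \<xi> i j) \<omega> = x b)" for \<omega>
  proof
    assume "restrict (\<lambda>(i, j). \<xi> i j \<omega>) ?I = x"
    then show "\<forall>b\<in>?I. (case b of (i, j) \<Rightarrow> \<xi> i j) \<omega> = x b" by auto
  next
    assume *: "\<forall>b\<in>?I. (case b of (i, j) \<Rightarrow> \<xi> i j) \<omega> = x b"
    show "restrict (\<lambda>(i, j). \<xi> i j \<omega>) ?I = x"
      by (rule PiE_ext[OF _ x]) (use * in auto)
  qed
  then have E: "E = (\<Inter>b\<in>?I. ?A b)" unfolding E_def using ne by auto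
  have A: "?A b \<in> events" if "b \<in> ?I" for b
  proof -
    have "(case b of (i, j) \<Rightarrow> \<xi> i j) \<in> measurable M (count_space UNIV)"
      using ind that unfolding indep_vars_def by blast
    then show ?thesis by (rule measurable_sets) simp
  qed
  show "E \<in> events" unfolding E using ne A by (intro sets.finite_INT) auto
  have "prob E = (\<Prod>b\<in>?I. prob (?A b))"
    unfolding E using ne by (intro indep_varsD[OF ind]) auto
  also have "\<dots> = (\<Prod>b\<in>?I. (1 - \<theta>\<^sup>2 / (real k)\<^sup>2) * (\<theta>\<^sup>2 / (real k)\<^sup>2) ^ x b)"
  proof (rule prod.cong[OF refl])
    fix b assume "b \<in> ?I"
    then obtain i j where b: "b = (i, j)" "i \<in> {1..k}" "j \<in> {1..k}" by blast
    have "?A b = {\<omega> \<in> space M. \<xi> i j \<omega> = x b}" using b(1) by auto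
    then show "prob (?A b) = (1 - \<theta>\<^sup>2 / (real k)\<^sup>2) * (\<theta>\<^sup>2 / (real k)\<^sup>2) ^ x b"
      using geo[OF b(2,3)] by simp
  qed
  finally show "prob E = (1 - \<theta>\<^sup>2 / (real k)\<^sup>2) ^ (k\<^sup>2) * (\<theta>\<^sup>2 / (real k)\<^sup>2) ^ (\<Sum>b\<in>?I. x b)"
    by (simp add: prod.distrib power_sum power2_eq_square[of k])
qed

text \<open>Turns the exponent in the weight of a matrix into the number of boxes, so that all
  matrices with a given shape are equally likely.\<close>

lemma sum_matrix_eq_card:
  assumes "diagram (growth (curry X) k k) = D"
  shows "(\<Sum>b\<in>{1..k} \<times> {1..k}. X b) = card D"
proof -
  have "card D = (\<Sum>r<k. growth (curry X) k k r)"
    using card_diagram[of k "growth (curry X) k k"] growth_vanish assms by blast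
  also have "\<dots> = (\<Sum>x=1..k. \<Sum>y=1..k. curry X x y)" by (rule growth_sum) simp
  finally show ?thesis by (simp add: sum.cartesian_product)
qed

lemma bij_betw_filter:
  assumes "bij_betw f A B" "\<And>x. x \<in> A \<Longrightarrow> P x \<longleftrightarrow> f x \<in> B'" "B' \<subseteq> B"
  shows "bij_betw f {x \<in> A. P x} B'"
proof (rule bij_betw_subset[OF assms(1)])
  show "f ` {x \<in> A. P x} = B'"
  proof (intro equalityI subsetI)
    fix y assume y: "y \<in> B'"
    then obtain x where "x \<in> A" "y = f x"
      using assms(3) bij_betw_imp_surj_on[OF assms(1)] by blast
    then show "y \<in> f ` {x \<in> A. P x}" using assms(2)[of x] y by simp
  qed (use assms(2) in blast)
qed blast

text \<open>At index 0 both sets are empty, because entries are positive and \<open>c 0 = 0\<close>.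
  This leaves exactly the indices that the event prescribes.\<close>

lemma mem_ssyt_through_iff:
  assumes "restrict T D \<in> ssyt k D" "c 0 = 0" "C 0 = {}" "c (Suc n) = k" "C (Suc n) = D"
  shows "restrict T D \<in> ssyt_through (Suc n) c C \<longleftrightarrow> (\<forall>i\<in>{1..n}. {b \<in> D. T b \<le> c i} = C i)"
proof -
  have "T b \<noteq> 0" if "b \<in> D" for b
    using assms(1) that PiE_mem[of "restrict T D" D "\<lambda>_. {1..k}" b] by (simp add: ssyt_def)
  then have zero: "{b \<in> D. T b \<le> c 0} = C 0" using assms(2,3) by auto
  have restr: "{b \<in> D. restrict T D b \<le> j} = {b \<in> D. T b \<le> j}" for j by auto
  have less: "{..<Suc n} = insert 0 {1..n}" by auto
  have "(\<forall>i<Suc n. {b \<in> D. T b \<le> c i} = C i) \<longleftrightarrow> (\<forall>i\<in>{..<Suc n}. {b \<in> D. T b \<le> c i} = C i)"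
    by blast
  also have "\<dots> \<longleftrightarrow> (\<forall>i\<in>{1..n}. {b \<in> D. T b \<le> c i} = C i)"
    unfolding less using zero by blast
  finally show ?thesis
    using assms(1) unfolding ssyt_through_def assms(4,5) mem_Collect_eq restr by blast
qed

theorem theorem5p7:
  fixes M :: "'a measure" and \<xi> :: "nat \<Rightarrow> nat \<Rightarrow> 'a \<Rightarrow> nat"
    and \<theta> :: real and k n m :: nat
    and t s :: "nat \<Rightarrow> real"
    and lam mu :: "nat \<Rightarrow> box set" and \<nu> :: "box set"
  assumes "prob_space M"
    and "\<theta> > 0" and "k \<ge> 1"
    and "prob_space.iid_geometric M \<theta> k \<xi>"
    and "strict_mono_on {1..n} t" and "\<forall>i\<in>{1..n}. t i \<in> {-\<theta>..0}"
    and "strict_mono_on {1..m} s" and "\<forall>j\<in>{1..m}. s j \<in> {0..\<theta>}"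
    and "\<forall>i\<in>{1..n}. young_diagram (lam i)"
    and "\<forall>j\<in>{1..m}. young_diagram (mu j)"
    and "young_diagram \<nu>"
    and "lam 0 = {}" and "lam (n + 1) = \<nu>" and "mu 0 = \<nu>" and "mu (m + 1) = {}"
    and "t 0 = -\<theta>" and "t (n + 1) = 0" and "s 0 = 0" and "s (m + 1) = \<theta>"
    and "\<forall>i\<in>{0..n}. lam i \<subseteq> lam (i + 1)"
    and "\<forall>j\<in>{0..m}. mu (j + 1) \<subseteq> mu j"
  shows "measure M {\<omega> \<in> space M.
             (\<forall>i\<in>{1..n}. geometric_rsk_process \<theta> k \<xi> \<omega> (t i) = lam i) \<and>
             geometric_rsk_process \<theta> k \<xi> \<omega> 0 = \<nu> \<and>
             (\<forall>j\<in>{1..m}. geometric_rsk_process \<theta> k \<xi> \<omega> (s j) = mu j)} =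
           (1 - \<theta>\<^sup>2 / (real k)\<^sup>2) ^ (k\<^sup>2) * (\<theta>\<^sup>2 / (real k)\<^sup>2) ^ card \<nu> *
           (\<Prod>i=0..n. real (skew_dim (lattice_count \<theta> k (\<theta> + t i) (\<theta> + t (i + 1)))
                                      (lam (i + 1)) (lam i))) *
           (\<Prod>i=0..m. real (skew_dim (lattice_count \<theta> k (\<theta> - s (i + 1)) (\<theta> - s i))
                                      (mu i) (mu (i + 1))))"
proof -
  note \<theta> = assms(2) and k = assms(3)
  interpret prob_space M by fact
  define a where "a i = grid_index \<theta> k (\<theta> + t i)" for i
  define b where "b j = grid_index \<theta> k (\<theta> - s j)" for j
  \<comment> \<open>\<open>mu\<close> decreases while \<open>card_ssyt_through\<close> expects an
    increasing chain, hence the reversed indices.\<close>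
  define c where "c j = b (Suc m - j)" for j
  define C where "C j = mu (Suc m - j)" for j
  let ?I = "{1..k} \<times> {1..k}"
  let ?L = "ssyt_through (Suc n) a lam" and ?R = "ssyt_through (Suc m) c C"
  define X where "X \<omega> = restrict (\<lambda>(i, j). \<xi> i j \<omega>) ?I" for \<omega>
  have ends: "a 0 = 0" "a (Suc n) = k" "c 0 = 0" "c (Suc m) = k" "b 0 = k" "b (Suc m) = 0"
    using \<theta> assms(16-19) by (simp_all add: a_def b_def c_def grid_index_end)
  have ends': "lam (Suc n) = \<nu>" "C 0 = {}" "C (Suc m) = \<nu>"
    using assms(13-15) by (simp_all add: C_def)
  have t_range: "-\<theta> \<le> t i \<and> t i \<le> 0" if "i \<le> Suc n" for i
    using that assms(6,16,17) \<theta> by (cases "i = 0"; cases "i = Suc n") auto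
  have s_range: "0 \<le> s i \<and> s i \<le> \<theta>" if "i \<le> Suc m" for i
    using that assms(8,18,19) \<theta> by (cases "i = 0"; cases "i = Suc m") auto
  \<comment> \<open>The conventional end points lie outside the range of
    \<open>strict_mono_on\<close>; there the bounds on the times are used instead.\<close>
  have t_mono: "t i \<le> t (Suc i)" if "i \<le> n" for i
  proof (cases "i = 0 \<or> i = n")
    case True
    then show ?thesis using t_range[of 1] t_range[of n] assms(16,17) by auto
  next
    case False
    then show ?thesis using strict_mono_onD[OF assms(5), of i "Suc i"] that by simp
  qed
  have s_mono: "s i \<le> s (Suc i)" if "i \<le> m" for i
  proof (cases "i = 0 \<or> i = m")
    case True
    then show ?thesis using s_range[of 1] s_range[of m] assms(18,19) by auto
  next
    case False
    then show ?thesis using strict_mono_onD[OF assms(7), of i "Suc i"] that by simp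
  qed
  have a_mono: "a i \<le> a (Suc i)" if "i \<le> n" for i
    unfolding a_def using t_mono[OF that] by (intro grid_index_mono[OF \<theta>]) simp
  have b_mono: "b (Suc i) \<le> b i" if "i \<le> m" for i
    unfolding b_def using s_mono[OF that] by (intro grid_index_mono[OF \<theta>]) simp
  have empty: "young_diagram {}"
    unfolding young_diagram_def partition_seq_def by (intro exI[of _ "\<lambda>_. 0"]) auto
  have young_lam: "young_diagram (lam i)" if "i \<le> Suc n" for i
    using that assms(9,11-13) empty by (cases "i = 0"; cases "i = Suc n") auto
  have young_mu: "young_diagram (mu i)" if "i \<le> Suc m" for i
    using that assms(10,11,14,15) empty by (cases "i = 0"; cases "i = Suc m") auto

  have card_L: "real (card ?L) = (\<Prod>i=0..n. real (skew_dim (lattice_count \<theta> k (\<theta> + t i) (\<theta> + t (i + 1)))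
                                      (lam (i + 1)) (lam i)))"
  proof -
    have "card ?L = (\<Prod>i<Suc n. card (ssyt (a (Suc i) - a i) (lam (Suc i) - lam i)))"
      using young_lam a_mono assms(12,20) by (intro card_ssyt_through) auto
    also have "\<dots> = (\<Prod>i=0..n. skew_dim (lattice_count \<theta> k (\<theta> + t i) (\<theta> + t (i + 1))) (lam (i + 1)) (lam i))"
    proof (rule prod.cong)
      fix i assume "i \<in> {0..n}"
      then have i: "i \<le> n" by simp
      have "lattice_count \<theta> k (\<theta> + t i) (\<theta> + t (Suc i)) = a (Suc i) - a i"
        unfolding a_def using t_range[of i] t_range[of "Suc i"] t_mono[of i] i
        by (intro lattice_count_eq[OF \<theta> k]) auto
      then show "card (ssyt (a (Suc i) - a i) (lam (Suc i) - lam i)) =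
          skew_dim (lattice_count \<theta> k (\<theta> + t i) (\<theta> + t (i + 1))) (lam (i + 1)) (lam i)"
        by (simp add: skew_dim_eq_card_ssyt)
    qed auto
    finally show ?thesis by simp
  qed
  have card_R: "real (card ?R) = (\<Prod>i=0..m. real (skew_dim (lattice_count \<theta> k (\<theta> - s (i + 1)) (\<theta> - s i))
                                      (mu i) (mu (i + 1))))"
  proof -
    define g where "g i = card (ssyt (b i - b (Suc i)) (mu i - mu (Suc i)))" for i
    have "card ?R = (\<Prod>i<Suc m. card (ssyt (c (Suc i) - c i) (C (Suc i) - C i)))"
    proof (rule card_ssyt_through)
      show "young_diagram (C i)" for i unfolding C_def by (rule young_mu) simp
      fix i assume "i < Suc m"
      then have i: "Suc m - i = Suc (m - i)" "Suc m - Suc i = m - i" by auto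
      show "C i \<subseteq> C (Suc i)" unfolding C_def i using assms(21) by simp
      show "c i \<le> c (Suc i)" unfolding c_def i by (rule b_mono) simp
    qed (rule ends')
    also have "\<dots> = (\<Prod>i<Suc m. g (Suc m - Suc i))"
    proof (rule prod.cong[OF refl])
      fix i assume "i \<in> {..<Suc m}"
      then have i: "Suc m - i = Suc (m - i)" "Suc m - Suc i = m - i" by auto
      show "card (ssyt (c (Suc i) - c i) (C (Suc i) - C i)) = g (Suc m - Suc i)"
        unfolding c_def C_def g_def i ..
    qed
    also have "\<dots> = (\<Prod>i<Suc m. g i)" by (rule prod.nat_diff_reindex)
    also have "\<dots> = (\<Prod>i=0..m. skew_dim (lattice_count \<theta> k (\<theta> - s (i + 1)) (\<theta> - s i)) (mu i) (mu (i + 1)))"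
    proof (rule prod.cong)
      fix i assume "i \<in> {0..m}"
      then have i: "i \<le> m" by simp
      have "lattice_count \<theta> k (\<theta> - s (Suc i)) (\<theta> - s i) = b i - b (Suc i)"
        unfolding b_def using s_range[of i] s_range[of "Suc i"] s_mono[of i] i
        by (intro lattice_count_eq[OF \<theta> k]) auto
      then show "g i = skew_dim (lattice_count \<theta> k (\<theta> - s (i + 1)) (\<theta> - s i)) (mu i) (mu (i + 1))"
        by (simp add: skew_dim_eq_card_ssyt g_def)
    qed auto
    finally show ?thesis by simp
  qed

  let ?good = "\<lambda>x. (\<forall>i\<in>{1..n}. {d \<in> \<nu>. insertion_tableau k x d \<le> a i} = lam i) \<and>
     (\<forall>j\<in>{1..m}. {d \<in> \<nu>. recording_tableau k x d \<le> b j} = mu j)"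
  \<comment> \<open>The matrices that realise the event, with the shape condition standing for time
    0. Finiteness will come from the bijection with pairs of tableaux.\<close>
  define \<S> where "\<S> = {x \<in> {x \<in> ?I \<rightarrow>\<^sub>E UNIV. diagram (growth (curry x) k k) = \<nu>}. ?good x}"
  have "bij_betw (\<lambda>x. (restrict (insertion_tableau k x) \<nu>, restrict (recording_tableau k x) \<nu>)) \<S> (?L \<times> ?R)"
    unfolding \<S>_def
  proof (rule bij_betw_filter[OF rsk_bij_betw[OF assms(11)]])
    show "?L \<times> ?R \<subseteq> ssyt k \<nu> \<times> ssyt k \<nu>"
      using ends ends' by (auto simp: ssyt_through_def)
    fix x assume "x \<in> {x \<in> ?I \<rightarrow>\<^sub>E UNIV. diagram (growth (curry x) k k) = \<nu>}"
    then have "restrict (insertion_tableau k x) \<nu> \<in> ssyt k \<nu>" "restrict (recording_tableau k x) \<nu> \<in> ssyt k \<nu>"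
      using bij_betwE[OF rsk_bij_betw[OF assms(11), of k]] by blast+
    note iff = mem_ssyt_through_iff[OF this(1) ends(1) assms(12) ends(2) ends'(1)]
      mem_ssyt_through_iff[OF this(2) ends(3) ends'(2) ends(4) ends'(3)]
    have "(\<forall>j\<in>{1..m}. {d \<in> \<nu>. recording_tableau k x d \<le> b j} = mu j) \<longleftrightarrow>
        (\<forall>j\<in>{1..m}. {d \<in> \<nu>. recording_tableau k x d \<le> c j} = C j)"
    proof -
      have "(\<forall>j\<in>{1..m}. P j) \<longleftrightarrow> (\<forall>j\<in>{1..m}. P (Suc m - j))" for P
      proof
        assume *: "\<forall>j\<in>{1..m}. P (Suc m - j)"
        show "\<forall>j\<in>{1..m}. P j"
        proof
          fix j assume "j \<in> {1..m}"
          then have "Suc m - j \<in> {1..m}" "Suc m - (Suc m - j) = j" by auto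
          then show "P j" using * by metis
        qed
      next
        assume *: "\<forall>j\<in>{1..m}. P j"
        show "\<forall>j\<in>{1..m}. P (Suc m - j)"
        proof
          fix j assume "j \<in> {1..m}"
          then have "Suc m - j \<in> {1..m}" by auto
          then show "P (Suc m - j)" using * by blast
        qed
      qed
      then show ?thesis unfolding c_def C_def .
    qed
    then show "?good x \<longleftrightarrow> (restrict (insertion_tableau k x) \<nu>, restrict (recording_tableau k x) \<nu>) \<in> ?L \<times> ?R"
      using iff by simp
  qed
  moreover have "finite (?L \<times> ?R)"
  proof (rule finite_subset)
    show "?L \<times> ?R \<subseteq> ssyt k \<nu> \<times> ssyt k \<nu>"
      using ends ends' by (auto simp: ssyt_through_def)
    show "finite (ssyt k \<nu> \<times> ssyt k \<nu>)"
      using finite_ssyt young_diagram_finite[OF assms(11)] by blast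
  qed
  ultimately have fin: "finite \<S>" and card_S: "card \<S> = card ?L * card ?R"
    by (simp_all only: bij_betw_finite bij_betw_same_card card_cartesian_product)

  have process: "geometric_rsk_process \<theta> k \<xi> \<omega> u = pair_process \<theta> k (rsk k (curry (X \<omega>))) u" for \<omega> u
  proof -
    have "rsk k (\<lambda>i j. \<xi> i j \<omega>) = rsk k (curry (X \<omega>))" by (rule rsk_cong) (simp add: X_def)
    then show ?thesis by (simp add: geometric_rsk_process_def)
  qed
  have "(\<forall>i\<in>{1..n}. geometric_rsk_process \<theta> k \<xi> \<omega> (t i) = lam i) \<and>
     geometric_rsk_process \<theta> k \<xi> \<omega> 0 = \<nu> \<and>
     (\<forall>j\<in>{1..m}. geometric_rsk_process \<theta> k \<xi> \<omega> (s j) = mu j) \<longleftrightarrow> X \<omega> \<in> \<S>" for \<omega>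
  proof -
    let ?D = "diagram (growth (curry (X \<omega>)) k k)"
    have p0: "pair_process \<theta> k (rsk k (curry (X \<omega>))) 0 = ?D"
      using pair_process_rsk(1)[OF \<theta> k, of 0] \<theta>
        insertion_tableau_sublevel[OF refl order_refl, of "X \<omega>" k]
      by (simp add: grid_index_end)
    have "pair_process \<theta> k (rsk k (curry (X \<omega>))) (t i) =
        {d \<in> ?D. insertion_tableau k (X \<omega>) d \<le> a i}" if "i \<in> {1..n}" for i
      unfolding a_def using that t_range[of i] by (intro pair_process_rsk(1)[OF \<theta> k]) simp_all
    then have p1: "(\<forall>i\<in>{1..n}. pair_process \<theta> k (rsk k (curry (X \<omega>))) (t i) = lam i) \<longleftrightarrow>
        (\<forall>i\<in>{1..n}. {d \<in> ?D. insertion_tableau k (X \<omega>) d \<le> a i} = lam i)"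
      by (intro ball_cong refl) simp
    have "pair_process \<theta> k (rsk k (curry (X \<omega>))) (s i) =
        {d \<in> ?D. recording_tableau k (X \<omega>) d \<le> b i}" if "i \<in> {1..m}" for i
      unfolding b_def using that s_range[of i] by (intro pair_process_rsk(2)[OF \<theta> k]) simp_all
    then have p2: "(\<forall>i\<in>{1..m}. pair_process \<theta> k (rsk k (curry (X \<omega>))) (s i) = mu i) \<longleftrightarrow>
        (\<forall>i\<in>{1..m}. {d \<in> ?D. recording_tableau k (X \<omega>) d \<le> b i} = mu i)"
      by (intro ball_cong refl) simp
    have "X \<omega> \<in> ?I \<rightarrow>\<^sub>E UNIV" by (simp add: X_def PiE_iff)
    \<comment> \<open>The condition at time 0 says \<open>?D = \<nu>\<close>, so sublevel sets of
      \<open>?D\<close> become sublevel sets in \<open>\<nu>\<close>; otherwise both sides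
      fail.\<close>
    then show ?thesis
      unfolding process p0 p1 p2 \<S>_def mem_Collect_eq by (cases "?D = \<nu>") (simp_all only: simp_thms)
  qed
  then have "{\<omega> \<in> space M.
             (\<forall>i\<in>{1..n}. geometric_rsk_process \<theta> k \<xi> \<omega> (t i) = lam i) \<and>
             geometric_rsk_process \<theta> k \<xi> \<omega> 0 = \<nu> \<and>
             (\<forall>j\<in>{1..m}. geometric_rsk_process \<theta> k \<xi> \<omega> (s j) = mu j)} =
      (\<Union>x\<in>\<S>. {\<omega> \<in> space M. X \<omega> = x})" (is "?E = _") by auto
  moreover have ev: "{\<omega> \<in> space M. X \<omega> = x} \<in> events"
    "prob {\<omega> \<in> space M. X \<omega> = x} = (1 - \<theta>\<^sup>2 / (real k)\<^sup>2) ^ (k\<^sup>2) * (\<theta>\<^sup>2 / (real k)\<^sup>2) ^ card \<nu>"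
    if "x \<in> \<S>" for x
  proof -
    have x: "x \<in> ?I \<rightarrow>\<^sub>E UNIV" "diagram (growth (curry x) k k) = \<nu>" using that by (auto simp: \<S>_def)
    note iid_geometric_prob[OF assms(4) k x(1), folded X_def, unfolded sum_matrix_eq_card[OF x(2)]]
    then show "{\<omega> \<in> space M. X \<omega> = x} \<in> events"
      "prob {\<omega> \<in> space M. X \<omega> = x} = (1 - \<theta>\<^sup>2 / (real k)\<^sup>2) ^ (k\<^sup>2) * (\<theta>\<^sup>2 / (real k)\<^sup>2) ^ card \<nu>"
      by auto
  qed
  moreover have "prob (\<Union>x\<in>\<S>. {\<omega> \<in> space M. X \<omega> = x}) = (\<Sum>x\<in>\<S>. prob {\<omega> \<in> space M. X \<omega> = x})"
  proof (rule finite_measure_finite_Union[OF fin])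
    show "(\<lambda>x. {\<omega> \<in> space M. X \<omega> = x}) ` \<S> \<subseteq> events" using ev(1) by blast
    show "disjoint_family_on (\<lambda>x. {\<omega> \<in> space M. X \<omega> = x}) \<S>" by (auto simp: disjoint_family_on_def)
  qed
  ultimately have "prob ?E = (\<Sum>x\<in>\<S>. prob {\<omega> \<in> space M. X \<omega> = x})" by simp
  also have "\<dots> = (1 - \<theta>\<^sup>2 / (real k)\<^sup>2) ^ (k\<^sup>2) * (\<theta>\<^sup>2 / (real k)\<^sup>2) ^ card \<nu> * real (card ?L) * real (card ?R)"
    by (simp add: ev card_S)
  finally show ?thesis unfolding card_L card_R .
qed

end
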